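(* Let $K_G$ be the real Grothendieck constant and let $K_{DR}$ be the Davie--Reeds lower bound (both defined in the context). Then $$K_G \ge K_{DR} + 10^{-12}.$$
   Context: The real Grothendieck constant is $$K_G := \sup_{n \in \mathbb{N}}\ \sup_{A \in \mathbb{R}^{n \times n},\,A\neq 0}\ \frac{\max_{\|x_i\|_2 = 1,\ \|y_j\|_2 = 1}\ \sum_{i,j = 1}^n A_{ij} \langle x_i, y_j\rangle}{\max_{x_i \in \{\pm1\},\ y_j \in \{\pm1 \}}\ \sum_{i,j = 1}^n A_{ij} x_i y_j},$$ where in the numerator $x_1,\dots,x_n,y_1,\dots,y_n$ range over unit vectors of real Euclidean (Hilbert) spaces of arbitrary dimension. Let $\phi(x) = \frac{1}{\sqrt{2\pi}}e^{-x^2/2}$ and $\Phi(x) = \int_{-\infty}^x \phi(t)\, dt$. Let $C^*\approx 0.25573$ be the unique solution in $(0,1)$ of $4\phi(C)^2 - 4\Phi(-C) + 1 = 0$, and let $\lambda^* = 2C^*\phi(C^* )\approx 0.19748$. The Davie--Reeds bound is $$K_{DR} = \frac{1-\lambda^*}{4\phi(C^* )^2 - \lambda^*\,(4\Phi(-C^* ) - 1)} \approx 1.6769 .$$ *)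

theory Defs
  imports "HOL-Probability.Probability"
begin

text \<open>An \<open>n \<times> n\<close> real matrix is a function \<open>A :: nat \<Rightarrow> nat \<Rightarrow> real\<close> of which only the entries
  \<open>A i j\<close> with \<open>i, j < n\<close> matter. A vector of the Euclidean space of dimension \<open>d\<close> is likewise
  given by its coordinates \<open>0, \<dots>, d - 1\<close>.\<close>

definition euclidean_inner :: "nat \<Rightarrow> (nat \<Rightarrow> real) \<Rightarrow> (nat \<Rightarrow> real) \<Rightarrow> real" where
  "euclidean_inner d u v = (\<Sum>k<d. u k * v k)"

text \<open>The dimension \<open>d\<close> is arbitrary, and finite dimensions suffice: \<open>2 n\<close> vectors of a Hilbert
  space span a subspace of dimension at most \<open>2 n\<close>. Together with compactness of the
  unit spheres of that dimension this also shows that the supremum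
  is attained. The set is nonempty and bounded above by the sum of the \<open>\<bar>A i j\<bar>\<close>, so its real
  \<open>Sup\<close> is the genuine one.\<close>

definition vector_max :: "nat \<Rightarrow> (nat \<Rightarrow> nat \<Rightarrow> real) \<Rightarrow> real" where
  "vector_max n A =
     Sup {(\<Sum>i<n. \<Sum>j<n. A i j * euclidean_inner d (x i) (y j)) | d x y.
            (\<forall>i<n. L2_set (x i) {..<d} = 1) \<and> (\<forall>j<n. L2_set (y j) {..<d} = 1)}"

text \<open>The sign vectors are taken extensional on \<open>{..<n}\<close>, so there are finitely many.\<close>

definition sign_max :: "nat \<Rightarrow> (nat \<Rightarrow> nat \<Rightarrow> real) \<Rightarrow> real" where
  "sign_max n A =
     Max {(\<Sum>i<n. \<Sum>j<n. A i j * x i * y j) | x y.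
            x \<in> {..<n} \<rightarrow>\<^sub>E {-1, 1} \<and> y \<in> {..<n} \<rightarrow>\<^sub>E {-1, 1}}"

text \<open>The supremum is taken in the extended reals, so that the definition does not presuppose
  Grothendieck's inequality (finiteness of the constant). For \<open>n = 0\<close> there is no nonzero matrix
  and the inner supremum is \<open>-\<infinity>\<close>, which does not affect the outer one.\<close>

definition grothendieck_constant :: ereal where
  "grothendieck_constant =
     (SUP n :: nat. SUP A \<in> {A. \<exists>i<n. \<exists>j<n. A i j \<noteq> 0}.
        ereal (vector_max n A / sign_max n A))"

definition std_normal_cdf :: "real \<Rightarrow> real" where
  "std_normal_cdf x = (LBINT t:{..x}. std_normal_density t)"

definition C_star :: real where
  "C_star = (THE C. 0 < C \<and> C < 1 \<and>
     4 * (std_normal_density C)\<^sup>2 - 4 * std_normal_cdf (- C) + 1 = 0)"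

definition lambda_star :: real where
  "lambda_star = 2 * C_star * std_normal_density C_star"

definition davie_reeds_bound :: real where
  "davie_reeds_bound = (1 - lambda_star) /
     (4 * (std_normal_density C_star)\<^sup>2 - lambda_star * (4 * std_normal_cdf (- C_star) - 1))"

end

theory Submission
  imports Defs "HOL-Real_Asymp.Real_Asymp"
begin

text \<open>On Gaussian space consider the form \<open>\<langle>f, (P - \<alpha> - \<beta> T) g\<rangle>\<close>, where \<open>P\<close> is the projection onto
  linear functions, \<open>T\<close> is the noise operator with correlation \<open>1 - \<kappa>\<close>, and \<open>\<alpha> + \<beta> = \<lambda>\<^sup>*\<close>; for \<open>\<beta> = 0\<close>
  this is the Davie--Reeds operator. On the vector-valued function \<open>x / \<bar>x\<bar>\<close> the form tends to
  \<open>1 - \<lambda>\<^sup>* + \<beta> \<kappa>\<close> as the dimension grows, a gain of first order in \<open>\<kappa>\<close>.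

  For sign functions write \<open>f = U + V\<close> and \<open>g = U - V\<close>, where \<open>U\<close> and \<open>V\<close> have complementary supports. Then
  \<open>U(x) U(y) - V(x) V(y) \<ge> \<bar>U(x)\<bar> + \<bar>U(y)\<bar> - 1 - 2 [U(x) U(y) = -1]\<close>, so up to the last term
  \<open>T\<close> is bounded like the identity and the Davie--Reeds bound for \<open>\<lambda>\<^sup>*\<close> applies. The last term is paid for
  pointwise, unless the components of \<open>x\<close> and \<open>y\<close> along the direction of \<open>P U\<close> differ by a fixed
  amount; this has probability \<open>O(\<kappa>\<^sup>2)\<close>. For small \<open>\<kappa>\<close> the gain therefore exceeds the loss.\<close>

section \<open>The standard normal distribution function and the constant \<open>C\<^sup>*\<close>\<close>

lemma integrable_std_normal_density_tail:
  "set_integrable lborel S std_normal_density" if "S \<in> sets borel"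
  unfolding set_integrable_def
  using that by (intro integrable_mult_indicator) auto

lemma std_normal_cdf_minus_eq: "std_normal_cdf (- w) = (LBINT t:{w..}. std_normal_density t)"
proof -
  have "std_normal_cdf (- w) = (LBINT t. indicator {..-w} t *\<^sub>R std_normal_density t)"
    by (simp add: std_normal_cdf_def set_lebesgue_integral_def)
  also have "\<dots> = (LBINT t. indicator {..-w} (-t) *\<^sub>R std_normal_density (-t))"
    using lborel_integral_real_affine[of "-1" "\<lambda>t. indicator {..-w} t *\<^sub>R std_normal_density t" 0]
    by simp
  also have "\<dots> = (LBINT t. indicator {w..} t *\<^sub>R std_normal_density t)"
    by (intro Bochner_Integration.integral_cong) (auto simp: indicator_def std_normal_density_def)
  finally show ?thesis by (simp add: set_lebesgue_integral_def)
qed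

lemma std_normal_cdf_minus: "std_normal_cdf (- w) = 1 - std_normal_cdf w"
proof -
  have "AE x in lborel. \<not> (x \<in> {..w} \<and> x \<in> {w..})"
    using AE_lborel_singleton[of w] by eventually_elim auto
  then have "(LBINT t:{..w} \<union> {w..}. std_normal_density t) =
      (LBINT t:{..w}. std_normal_density t) + (LBINT t:{w..}. std_normal_density t)"
    by (intro set_integral_Un_AE) (auto intro!: integrable_std_normal_density_tail)
  moreover have "{..w} \<union> {w..} = (UNIV::real set)" by auto
  moreover have "(LBINT t:UNIV. std_normal_density t) = 1"
    by (simp add: set_lebesgue_integral_def)
  ultimately show ?thesis
    unfolding std_normal_cdf_minus_eq by (simp add: std_normal_cdf_def)
qed

lemma isCont_std_normal_density: "isCont std_normal_density x"
  unfolding std_normal_density_def by (intro continuous_intros) auto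

lemma DERIV_std_normal_density [derivative_intros]:
  "(f has_real_derivative f') (at x) \<Longrightarrow>
   ((\<lambda>x. std_normal_density (f x)) has_real_derivative (- f x * std_normal_density (f x)) * f') (at x)"
  unfolding std_normal_density_def
  by (auto intro!: derivative_eq_intros simp: field_simps)

lemma DERIV_std_normal_cdf_at: "(std_normal_cdf has_real_derivative std_normal_density x) (at x)"
proof -
  \<comment> \<open>\<open>integral_has_real_derivative\<close> concerns integrals over a compact
    interval. The mass below the base point \<open>a\<close> is constant, and \<open>x\<close> is
    interior to \<open>{a..b}\<close>, so the derivative within the interval is the full
    one.\<close>
  define a b where "a = x - 1" and "b = x + 1"
  have eq: "std_normal_cdf y = std_normal_cdf a + integral {a..y} std_normal_density" if "y \<in> {a..b}" for y
  proof -
    have "AE z in lborel. \<not> (z \<in> {..a} \<and> z \<in> {a..y})"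
      using AE_lborel_singleton[of a] by eventually_elim auto
    then have "(LBINT t:{..a} \<union> {a..y}. std_normal_density t) =
        (LBINT t:{..a}. std_normal_density t) + (LBINT t:{a..y}. std_normal_density t)"
      by (intro set_integral_Un_AE) (auto intro!: integrable_std_normal_density_tail)
    moreover have "{..a} \<union> {a..y} = {..y}" using that by auto
    moreover have "(LBINT t:{a..y}. std_normal_density t) = integral {a..y} std_normal_density"
      by (intro set_borel_integral_eq_integral integrable_std_normal_density_tail) auto
    ultimately show ?thesis by (simp add: std_normal_cdf_def)
  qed
  have "((\<lambda>y. integral {a..y} std_normal_density) has_real_derivative std_normal_density x)
      (at x within {a..b})"
    by (intro integral_has_real_derivative continuous_at_imp_continuous_on)
       (auto simp: a_def b_def isCont_std_normal_density)
  then have "((\<lambda>y. std_normal_cdf a + integral {a..y} std_normal_density)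
      has_real_derivative 0 + std_normal_density x) (at x within {a..b})"
    by (intro DERIV_add DERIV_const)
  then have "((\<lambda>y. std_normal_cdf a + integral {a..y} std_normal_density)
      has_real_derivative std_normal_density x) (at x within {a..b})"
    by simp
  then have "(std_normal_cdf has_real_derivative std_normal_density x) (at x within {a..b})"
  proof (rule has_field_derivative_transform_within[where d=1])
    show "x \<in> {a..b}" by (simp add: a_def b_def)
  qed (simp_all add: eq[symmetric])
  moreover have "x \<in> interior {a..b}" by (simp add: a_def b_def)
  ultimately show ?thesis
    by (simp only: at_within_interior)
qed

lemmas DERIV_std_normal_cdf [derivative_intros] = DERIV_std_normal_cdf_at[THEN DERIV_chain2]

lemma isCont_std_normal_cdf: "isCont std_normal_cdf x"
  using DERIV_std_normal_cdf_at by (rule DERIV_isCont)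

section \<open>The equation for \<open>C_star\<close> and the location of its root\<close>

definition davie_reeds_eqn :: "real \<Rightarrow> real" where
  "davie_reeds_eqn C = 4 * (std_normal_density C)\<^sup>2 - 4 * std_normal_cdf (- C) + 1"

lemma continuous_on_davie_reeds_eqn: "continuous_on S davie_reeds_eqn"
  unfolding davie_reeds_eqn_def
  by (intro continuous_at_imp_continuous_on ballI)
     (auto intro!: continuous_intros isCont_std_normal_density isCont_o2[OF _ isCont_std_normal_cdf])

lemma std_normal_density_antimono:
  assumes "0 \<le> x" "x \<le> y"
  shows "std_normal_density y \<le> std_normal_density x"
  using assms unfolding std_normal_density_def
  by (intro mult_left_mono) (auto intro: power_mono)

lemma std_normal_cdf_0: "std_normal_cdf 0 = 1 / 2"
  using std_normal_cdf_minus[of 0] by simp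

text \<open>By the mean value theorem the mass of [-w, 0] is w times a value of the density there,
  which lies between the values at w and at 0.\<close>

lemma std_normal_cdf_minus_bounds:
  assumes "0 < w"
  shows "1 / 2 - w * std_normal_density 0 \<le> std_normal_cdf (- w)"
    and "std_normal_cdf (- w) \<le> 1 / 2 - w * std_normal_density w"
proof -
  obtain z where z: "- w < z" "z < 0" "std_normal_cdf 0 - std_normal_cdf (- w) = (0 - (- w)) * std_normal_density z"
    using MVT2[of "-w" 0 std_normal_cdf std_normal_density] assms DERIV_std_normal_cdf_at by auto
  have "std_normal_density z = std_normal_density (- z)"
    by (simp add: std_normal_density_def)
  then have "std_normal_density z \<le> std_normal_density 0" "std_normal_density w \<le> std_normal_density z"
    using z by (auto intro!: std_normal_density_antimono)
  then have "w * std_normal_density z \<le> w * std_normal_density 0" "w * std_normal_density w \<le> w * std_normal_density z"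
    using assms by auto
  moreover have "std_normal_cdf (- w) = 1 / 2 - w * std_normal_density z"
    using z(3) std_normal_cdf_0 by simp
  ultimately show "1 / 2 - w * std_normal_density 0 \<le> std_normal_cdf (- w)"
    "std_normal_cdf (- w) \<le> 1 / 2 - w * std_normal_density w" by linarith+
qed

lemma std_normal_density_sq: "(std_normal_density x)\<^sup>2 = exp (- x\<^sup>2) / (2 * pi)"
  by (simp add: std_normal_density_def power_mult_distrib power_divide flip: exp_double)

lemma std_normal_density_0_bounds: "199 / 500 < std_normal_density 0" "std_normal_density 0 < 2 / 5"
proof -
  have p: "31415 / 10000 < pi" "pi < 31416 / 10000" using pi_approx by auto
  have "(std_normal_density 0)\<^sup>2 = 1 / (2 * pi)" by (simp add: std_normal_density_sq)
  moreover have "(199 / 500)\<^sup>2 < 1 / (2 * pi)" "1 / (2 * pi) < (2 / 5)\<^sup>2"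
    using p by (auto simp: field_simps power2_eq_square)
  ultimately show "199 / 500 < std_normal_density 0" "std_normal_density 0 < 2 / 5"
    using power2_less_imp_less[of "199 / 500" "std_normal_density 0"] power2_less_imp_less[of "std_normal_density 0" "2 / 5"] by simp_all
qed

lemma std_normal_density_bounds:
  "(1 - x\<^sup>2 / 2) * std_normal_density 0 \<le> std_normal_density x"
  "std_normal_density x \<le> std_normal_density 0"
proof -
  have "std_normal_density x = exp (- x\<^sup>2 / 2) * std_normal_density 0"
    by (simp add: std_normal_density_def)
  moreover have "1 - x\<^sup>2 / 2 \<le> exp (- x\<^sup>2 / 2)"
    using exp_ge_add_one_self[of "- x\<^sup>2 / 2"] by simp
  moreover have "exp (- x\<^sup>2 / 2) \<le> 1" by simp
  moreover have "0 \<le> std_normal_density 0" by simp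
  ultimately show "(1 - x\<^sup>2 / 2) * std_normal_density 0 \<le> std_normal_density x"
  "std_normal_density x \<le> std_normal_density 0"
    using mult_right_mono[of "exp (- x\<^sup>2 / 2)" 1 "std_normal_density 0"] by (auto simp: mult_right_mono)
qed

text \<open>With \<phi> the standard normal density, the derivative is 4 \<phi>(z) (1 - 2 z
  \<phi>(z)), which is positive because z \<phi>(z) < 2/5 on (0, 1).\<close>

lemma davie_reeds_eqn_strict_mono:
  assumes "0 \<le> x" "x < y" "y \<le> 1"
  shows "davie_reeds_eqn x < davie_reeds_eqn y"
proof (rule DERIV_pos_imp_increasing_open[OF \<open>x < y\<close>])
  fix z assume z: "x < z" "z < y"
  have "(davie_reeds_eqn has_real_derivative 4 * std_normal_density z * (1 - 2 * z * std_normal_density z)) (at z)"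
    unfolding davie_reeds_eqn_def
    by (auto intro!: derivative_eq_intros
        simp: std_normal_density_def field_simps power2_eq_square)
  moreover have "z * std_normal_density z < 1 * (2 / 5)"
    using z assms std_normal_density_bounds(2)[of z] std_normal_density_0_bounds(2)
    by (intro mult_strict_mono) auto
  ultimately show "\<exists>y. DERIV davie_reeds_eqn z :> y \<and> y > 0"
    by (intro exI[of _ "4 * std_normal_density z * (1 - 2 * z * std_normal_density z)"])
       (auto simp: normal_density_pos)
next
  show "continuous_on {x..y} davie_reeds_eqn"
    by (rule continuous_on_davie_reeds_eqn)
qed

text \<open>A coarse bracket of the root; the numerical bounds on \<open>lambda_star\<close> and on
  the density at \<open>C_star\<close> start from its end points.\<close>

lemma davie_reeds_eqn_signs: "davie_reeds_eqn (1 / 5) < 0" "0 < davie_reeds_eqn (3 / 10)"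
proof -
  note b = std_normal_density_0_bounds
  have e: "exp (- (1 / 25) :: real) \<le> 25 / 26"
    using exp_ge_add_one_self[of "1 / 25 :: real"] by (simp add: exp_minus field_simps)
  have "(std_normal_density (1 / 5))\<^sup>2 = exp (- (1 / 25)) / (2 * pi)"
    unfolding std_normal_density_sq by (simp add: power2_eq_square)
  also have "\<dots> \<le> (25 / 26) / (2 * pi)"
    using e by (intro divide_right_mono) auto
  also have "\<dots> \<le> 383 / 2500"
    using pi_approx by (simp add: field_simps)
  finally have "(std_normal_density (1 / 5))\<^sup>2 \<le> 383 / 2500" .
  then show "davie_reeds_eqn (1 / 5) < 0"
    using std_normal_cdf_minus_bounds(1)[of "1/5"] b by (simp add: davie_reeds_eqn_def)
  have "19 / 50 \<le> (1 - (3/10)\<^sup>2 / 2) * std_normal_density 0" using b by (simp add: power2_eq_square)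
  then have l: "(19 / 50) \<le> std_normal_density (3 / 10)"
    using std_normal_density_bounds(1)[of "3/10"] by linarith
  then have "(19 / 50)\<^sup>2 \<le> (std_normal_density (3 / 10))\<^sup>2" by (intro power_mono) auto
  then show "0 < davie_reeds_eqn (3 / 10)"
    using std_normal_cdf_minus_bounds(2)[of "3/10"] l by (simp add: davie_reeds_eqn_def power2_eq_square)
qed

text \<open>The intermediate value theorem gives a root in the bracket, and strict monotonicity
  makes it the only one in (0, 1), so the definite description denotes it.\<close>

lemma C_star_props:
  shows C_star_bounds: "1 / 5 < C_star" "C_star < 3 / 10"
    and C_star_eqn: "4 * (std_normal_density C_star)\<^sup>2 = 4 * std_normal_cdf (- C_star) - 1"
proof -
  have "\<exists>C. 1 / 5 \<le> C \<and> C \<le> 3 / 10 \<and> davie_reeds_eqn C = 0"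
    using davie_reeds_eqn_signs
    by (intro IVT' continuous_on_davie_reeds_eqn) auto
  then obtain C where C: "1 / 5 \<le> C" "C \<le> 3 / 10" "davie_reeds_eqn C = 0" by blast
  have "C_star = (THE C. 0 < C \<and> C < 1 \<and> davie_reeds_eqn C = 0)"
    by (simp only: C_star_def davie_reeds_eqn_def)
  also have "\<dots> = C"
  proof (rule the_equality)
    show "0 < C \<and> C < 1 \<and> davie_reeds_eqn C = 0" using C by (intro conjI) linarith+
  next
    fix D :: real assume D: "0 < D \<and> D < 1 \<and> davie_reeds_eqn D = 0"
    have "\<not> C < D"
      using davie_reeds_eqn_strict_mono[of C D] C D by linarith
    moreover have "\<not> D < C"
      using davie_reeds_eqn_strict_mono[of D C] C D by linarith
    ultimately show "D = C" by simp
  qed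
  finally have "C_star = C" .
  moreover have "1 / 5 < C"
  proof (rule ccontr)
    assume "\<not> 1 / 5 < C"
    with C(1) have "C = 1 / 5" by (intro antisym) (simp_all only: not_less)
    then have "davie_reeds_eqn (1 / 5) = 0" using C(3) by (rule subst)
    with davie_reeds_eqn_signs(1) show False by linarith
  qed
  moreover have "C < 3 / 10"
  proof (rule ccontr)
    assume "\<not> C < 3 / 10"
    with C(2) have "C = 3 / 10" by (intro antisym) (simp_all only: not_less)
    then have "davie_reeds_eqn (3 / 10) = 0" using C(3) by (rule subst)
    with davie_reeds_eqn_signs(2) show False by linarith
  qed
  moreover have "4 * (std_normal_density C)\<^sup>2 = 4 * std_normal_cdf (- C) - 1"
    using C(3) unfolding davie_reeds_eqn_def by linarith
  ultimately show "1 / 5 < C_star" "C_star < 3 / 10"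
    "4 * (std_normal_density C_star)\<^sup>2 = 4 * std_normal_cdf (- C_star) - 1"
    by (simp_all only:)
qed

section \<open>The one-dimensional Davie--Reeds problem\<close>

lemma tendsto_std_normal_density_at_top: "(std_normal_density \<longlongrightarrow> 0) at_top"
  unfolding std_normal_density_def by real_asymp

text \<open>The negative density is an antiderivative of the integrand and vanishes at
  infinity.\<close>

lemma has_bochner_integral_std_normal_first_moment_tail:
  assumes "0 \<le> w"
  shows "has_bochner_integral lborel (\<lambda>x. indicator {w..} x * (x * std_normal_density x)) (std_normal_density w)"
proof (rule has_bochner_integral_nn_integral)
  have "(\<integral>\<^sup>+x. ennreal (x * std_normal_density x) * indicator {w..} x \<partial>lborel) =
      ennreal (0 - (- std_normal_density w))"
  proof (rule nn_integral_FTC_atLeast)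
    show "((\<lambda>x. - std_normal_density x) has_real_derivative x * std_normal_density x) (at x)" for x
      by (rule DERIV_cong[OF DERIV_minus[OF DERIV_std_normal_density[OF DERIV_ident]]]) simp
    show "((\<lambda>x. - std_normal_density x) \<longlongrightarrow> 0) at_top"
      using tendsto_minus[OF tendsto_std_normal_density_at_top] by simp
  qed (use assms in auto)
  then show "(\<integral>\<^sup>+x. ennreal (indicator {w..} x * (x * std_normal_density x)) \<partial>lborel) =
      ennreal (std_normal_density w)"
    by (subst nn_integral_cong[where v="\<lambda>x. ennreal (x * std_normal_density x) * indicator {w..} x"])
       (auto simp: indicator_def)
qed (use assms in \<open>auto simp: indicator_def\<close>)

text \<open>The integrand lives on x \<ge> l / t, where it is the difference of a first-moment tail
  and a multiple of a probability tail.\<close>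

lemma has_bochner_integral_std_normal_positive_part:
  assumes "0 < t" "0 \<le> l"
  shows "has_bochner_integral lborel (\<lambda>x. std_normal_density x * max 0 (t * x - l))
     (t * std_normal_density (l / t) - l * std_normal_cdf (- (l / t)))"
proof -
  let ?w = "l / t"
  have "has_bochner_integral lborel (\<lambda>x. indicator {?w..} x * (x * std_normal_density x)) (std_normal_density ?w)"
    by (rule has_bochner_integral_std_normal_first_moment_tail) (use assms in auto)
  moreover have "has_bochner_integral lborel (\<lambda>x. indicator {?w..} x * std_normal_density x)
      (std_normal_cdf (- ?w))"
    using integrable_std_normal_density_tail[of "{?w..}"]
    by (simp add: has_bochner_integral_iff std_normal_cdf_minus_eq set_integrable_def set_lebesgue_integral_def)
  ultimately have "has_bochner_integral lborel
      (\<lambda>x. t * (indicator {?w..} x * (x * std_normal_density x)) - l * (indicator {?w..} x * std_normal_density x))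
      (t * std_normal_density (l / t) - l * std_normal_cdf (- (l / t)))"
    by (intro has_bochner_integral_diff has_bochner_integral_mult_right)
  moreover have "t * (indicator {?w..} x * (x * std_normal_density x)) - l * (indicator {?w..} x * std_normal_density x)
      = std_normal_density x * max 0 (t * x - l)" for x
    using assms by (cases "?w \<le> x") (auto simp: max_def field_simps)
  ultimately show ?thesis by simp
qed

lemma mult_std_normal_density_mono:
  assumes "0 \<le> x" "x \<le> y" "y \<le> 1"
  shows "x * std_normal_density x \<le> y * std_normal_density y"
proof (rule DERIV_nonneg_imp_nondecreasing[OF \<open>x \<le> y\<close>])
  fix z assume z: "x \<le> z" "z \<le> y"
  have "((\<lambda>x. x * std_normal_density x) has_real_derivative
      1 * std_normal_density z + (- z * std_normal_density z) * 1 * z) (at z)"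
    by (intro DERIV_mult DERIV_ident DERIV_std_normal_density)
  moreover have "z * z \<le> 1" using z assms by (intro mult_le_one) auto
  then have "0 \<le> (1 - z * z) * std_normal_density z" by simp
  then have "0 \<le> 1 * std_normal_density z + (- z * std_normal_density z) * 1 * z"
    by (simp add: algebra_simps)
  ultimately show "\<exists>y. ((\<lambda>x. x * std_normal_density x) has_real_derivative y) (at z) \<and> 0 \<le> y"
    by blast
qed

text \<open>Linearising \<open>a\<^sup>2\<close> at \<open>a = t\<close> turns the Davie--Reeds problem with parameter \<open>l\<close> into the
  expectation of a pointwise maximum, whose value is \<open>davie_reeds_dual l t\<close>.\<close>

definition davie_reeds_dual :: "real \<Rightarrow> real \<Rightarrow> real" where
  "davie_reeds_dual l t = l - t\<^sup>2 + 4 * (t * std_normal_density (l / t) - l * std_normal_cdf (- (l / t)))"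

text \<open>The two terms that come from moving the threshold \<open>l / t\<close> cancel, since the
  positive part vanishes there.\<close>

lemma DERIV_davie_reeds_dual:
  assumes "0 < t"
  shows "(davie_reeds_dual l has_real_derivative 4 * std_normal_density (l / t) - 2 * t) (at t)"
proof -
  have 1: "((\<lambda>t. l / t) has_real_derivative - l / t\<^sup>2) (at t)"
    using assms by (auto intro!: derivative_eq_intros simp: power2_eq_square)
  have 2: "((\<lambda>t. - (l / t)) has_real_derivative l / t\<^sup>2) (at t)"
    using DERIV_minus[OF 1] by simp
  have 3: "((\<lambda>t. t\<^sup>2) has_real_derivative 2 * t) (at t)"
    by (auto intro!: derivative_eq_intros)
  have "std_normal_density (- (l / t)) = std_normal_density (l / t)"
    by (simp add: std_normal_density_def)
  then show ?thesis
    unfolding davie_reeds_dual_def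
    using assms
    by (intro DERIV_cong[OF DERIV_add[OF DERIV_diff[OF DERIV_const 3] DERIV_cmult[OF DERIV_diff[OF
      DERIV_mult[OF DERIV_ident DERIV_std_normal_density[OF 1]] DERIV_cmult[OF DERIV_std_normal_cdf[OF 2]]]]]])
     (simp add: field_simps power2_eq_square)
qed

text \<open>With u = l / t, the derivative vanishes when u \<phi>(u) = l / 2 = c \<phi>(c). On
  [0, 1] the function u \<phi>(u) is increasing, and l \<le> t keeps u in that range, so the dual
  rises up to t = 2 \<phi>(c), where u = c, and falls afterwards.\<close>

lemma davie_reeds_dual_le:
  assumes c: "0 < c" "c \<le> 1" and l: "l = 2 * c * std_normal_density c" and t: "l \<le> t"
  shows "davie_reeds_dual l t \<le> davie_reeds_dual l (2 * std_normal_density c)"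
proof -
  define t0 where "t0 = 2 * std_normal_density c"
  have pos: "0 < std_normal_density c" by (simp add: normal_density_pos)
  then have "0 < l" "0 < t0" using c l by (auto simp: t0_def)
  with t have "0 < t" by simp
  have lt0: "l / t0 = c" using pos l by (simp add: t0_def)
  have "davie_reeds_dual l t \<le> davie_reeds_dual l t0"
  proof (cases "t \<le> t0")
    case True
    show ?thesis
    proof (rule DERIV_nonneg_imp_nondecreasing[OF True])
      fix s assume s: "t \<le> s" "s \<le> t0"
      have "c \<le> l / s" using s lt0 \<open>0 < t\<close> \<open>0 < l\<close> by (metis frac_le less_le_trans order_refl less_imp_le)
      moreover have "l / s \<le> 1" using s t \<open>0 < t\<close> by simp
      ultimately have "l / 2 \<le> l / s * std_normal_density (l / s)"
        using mult_std_normal_density_mono[of c "l / s"] c l by simp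
      then have "s / l * (l / 2) \<le> s / l * (l / s * std_normal_density (l / s))"
        using s \<open>0 < t\<close> \<open>0 < l\<close> by (intro mult_left_mono) auto
      then have "0 \<le> 4 * std_normal_density (l / s) - 2 * s"
        using s \<open>0 < t\<close> \<open>0 < l\<close> by simp
      then show "\<exists>y. DERIV (davie_reeds_dual l) s :> y \<and> 0 \<le> y"
        using DERIV_davie_reeds_dual[of s l] s \<open>0 < t\<close> by auto
    qed
  next
    case False
    show ?thesis
    proof (rule DERIV_nonpos_imp_nonincreasing[of t0 t])
      fix s assume s: "t0 \<le> s" "s \<le> t"
      have "l / s \<le> c" using s lt0 \<open>0 < t0\<close> \<open>0 < l\<close> by (metis frac_le less_le_trans order_refl less_imp_le)
      then have "l / s * std_normal_density (l / s) \<le> l / 2"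
        using mult_std_normal_density_mono[of "l / s" c] c l s \<open>0 < l\<close> \<open>0 < t0\<close> by simp
      then have "s / l * (l / s * std_normal_density (l / s)) \<le> s / l * (l / 2)"
        using s \<open>0 < t0\<close> \<open>0 < l\<close> by (intro mult_left_mono) auto
      then have "4 * std_normal_density (l / s) - 2 * s \<le> 0"
        using s \<open>0 < t0\<close> \<open>0 < l\<close> by simp
      then show "\<exists>y. DERIV (davie_reeds_dual l) s :> y \<and> y \<le> 0"
        using DERIV_davie_reeds_dual[of s l] s \<open>0 < t0\<close> by auto
    qed (use False in auto)
  qed
  then show ?thesis by (simp add: t0_def)
qed

section \<open>Numerical bounds and the value of the Davie--Reeds problem\<close>

lemma std_normal_density_C_star_bounds:
  "19 / 50 \<le> std_normal_density C_star" "std_normal_density C_star \<le> 2 / 5"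
proof -
  have "C_star\<^sup>2 \<le> (3 / 10)\<^sup>2" using C_star_bounds by (intro power_mono) linarith+
  then have "1 - 9 / 200 \<le> 1 - C_star\<^sup>2 / 2" by (simp add: power2_eq_square)
  then have "(1 - 9 / 200) * std_normal_density 0 \<le> (1 - C_star\<^sup>2 / 2) * std_normal_density 0"
    by (intro mult_right_mono) auto
  also have "\<dots> \<le> std_normal_density C_star" by (rule std_normal_density_bounds)
  finally have "191 / 200 * std_normal_density 0 \<le> std_normal_density C_star" by simp
  then show "19 / 50 \<le> std_normal_density C_star"
    using std_normal_density_0_bounds by linarith
  show "std_normal_density C_star \<le> 2 / 5"
    using std_normal_density_bounds(2)[of C_star] std_normal_density_0_bounds by linarith
qed

lemma lambda_star_bounds: "15 / 100 \<le> lambda_star" "lambda_star \<le> 24 / 100"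
proof -
  note b = std_normal_density_C_star_bounds C_star_bounds
  have "1 / 5 * (19 / 50) \<le> C_star * std_normal_density C_star"
    using b by (intro mult_mono) linarith+
  moreover have "C_star * std_normal_density C_star \<le> 3 / 10 * (2 / 5)"
    using b by (intro mult_mono) linarith+
  ultimately show "15 / 100 \<le> lambda_star" "lambda_star \<le> 24 / 100"
    unfolding lambda_star_def by linarith+
qed

lemma davie_reeds_value_bounds:
  "57 / 100 \<le> 4 * (std_normal_density C_star)\<^sup>2" "4 * (std_normal_density C_star)\<^sup>2 \<le> 64 / 100"
proof -
  note b = std_normal_density_C_star_bounds
  have "(19 / 50)\<^sup>2 \<le> (std_normal_density C_star)\<^sup>2" "(std_normal_density C_star)\<^sup>2 \<le> (2 / 5)\<^sup>2"
    using b by (intro power_mono; linarith)+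
  then show "57 / 100 \<le> 4 * (std_normal_density C_star)\<^sup>2" "4 * (std_normal_density C_star)\<^sup>2 \<le> 64 / 100"
    by (auto simp: power2_eq_square)
qed

text \<open>The equation for \<open>C_star\<close> makes both terms multiples of the same square, so
  the denominator factors and the Davie--Reeds bound becomes the reciprocal of
  \<open>4 * (std_normal_density C_star)\<^sup>2\<close>.\<close>

lemma davie_reeds_denominator_eq:
  "4 * (std_normal_density C_star)\<^sup>2 - lambda_star * (4 * std_normal_cdf (- C_star) - 1) =
     (1 - lambda_star) * (4 * (std_normal_density C_star)\<^sup>2)"
  unfolding C_star_eqn[symmetric] by (simp add: algebra_simps)

lemma davie_reeds_bound_eq: "davie_reeds_bound = 1 / (4 * (std_normal_density C_star)\<^sup>2)"
  using lambda_star_bounds by (simp add: davie_reeds_bound_def davie_reeds_denominator_eq)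

lemma davie_reeds_dual_lambda_star_le:
  assumes "lambda_star \<le> t"
  shows "davie_reeds_dual lambda_star t \<le> (1 - lambda_star) * (4 * (std_normal_density C_star)\<^sup>2)"
proof -
  have pos: "0 < std_normal_density C_star" by (simp add: normal_density_pos)
  have "davie_reeds_dual lambda_star t \<le> davie_reeds_dual lambda_star (2 * std_normal_density C_star)"
    using C_star_bounds assms by (intro davie_reeds_dual_le) (auto simp: lambda_star_def)
  also have "lambda_star / (2 * std_normal_density C_star) = C_star"
    using pos by (simp add: lambda_star_def)
  then have "davie_reeds_dual lambda_star (2 * std_normal_density C_star) =
      4 * (std_normal_density C_star)\<^sup>2 - lambda_star * (4 * std_normal_cdf (- C_star) - 1)"
    by (simp add: davie_reeds_dual_def algebra_simps power2_eq_square)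
  finally show ?thesis unfolding davie_reeds_denominator_eq .
qed

text \<open>This covers the range in which \<open>lambda_star / t\<close> may exceed 1, outside the
  reach of the monotonicity argument. Numerically the left side is below 0.3 and the right side
  above 0.43.\<close>

lemma sq_add_lambda_star_le:
  assumes "0 \<le> t" "t \<le> lambda_star"
  shows "t\<^sup>2 + lambda_star \<le> (1 - lambda_star) * (4 * (std_normal_density C_star)\<^sup>2)"
proof -
  have "t\<^sup>2 \<le> (24 / 100)\<^sup>2"
    using assms lambda_star_bounds by (intro power_mono) auto
  moreover have "76 / 100 * (57 / 100) \<le> (1 - lambda_star) * (4 * (std_normal_density C_star)\<^sup>2)"
    using lambda_star_bounds davie_reeds_value_bounds by (intro mult_mono) auto
  ultimately show ?thesis using lambda_star_bounds by (simp add: power2_eq_square)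
qed

section \<open>The bound for sign functions\<close>

lemma (in prob_space) normal_moments:
  assumes D: "distributed M lborel X (normal_density 0 s)" and s: "0 < s"
  shows "integrable M X" "integrable M (\<lambda>w. (X w)\<^sup>2)" "integrable M (\<lambda>w. (X w) ^ 4)"
    "expectation (\<lambda>w. (X w)\<^sup>2) = s\<^sup>2" "expectation (\<lambda>w. (X w) ^ 4) = 3 * s ^ 4"
proof -
  have int: "integrable M (\<lambda>w. (X w) ^ k)" for k
    using integrable_normal_moment[OF s, of 0 k] distributed_integrable[OF D, of "\<lambda>x. x ^ k"] by simp
  show "integrable M X" using int[of 1] by simp
  show "integrable M (\<lambda>w. (X w)\<^sup>2)" "integrable M (\<lambda>w. (X w) ^ 4)" by (rule int)+
  have E: "expectation (\<lambda>w. (X w) ^ (2 * k)) = fact (2 * k) / ((2 / s\<^sup>2) ^ k * fact k)" for k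
    using integral_normal_moment_even[OF s, of 0 k] distributed_integral[OF D, of "\<lambda>x. x ^ (2 * k)"] by simp
  show "expectation (\<lambda>w. (X w)\<^sup>2) = s\<^sup>2" using E[of 1] by simp
  show "expectation (\<lambda>w. (X w) ^ 4) = 3 * s ^ 4"
    using E[of 2] s by (simp add: fact_numeral power2_eq_square power4_eq_xxxx)
qed

text \<open>\<open>X\<close> and \<open>Y\<close> are the coordinates of standard Gaussian vectors in \<open>\<real>\<^sup>n\<close> with correlation \<open>1 - \<kappa>\<close>.\<close>

locale coupled_gaussian_vectors = prob_space M for M :: "'a measure" +
  fixes n :: nat and X Y :: "nat \<Rightarrow> 'a \<Rightarrow> real" and \<kappa> :: real
  assumes n_pos: "0 < n" and kappa_pos: "0 < \<kappa>"
    and X_measurable: "\<And>k. k < n \<Longrightarrow> X k \<in> borel_measurable M"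
    and Y_measurable: "\<And>k. k < n \<Longrightarrow> Y k \<in> borel_measurable M"
    and X_normal: "\<And>e. (\<Sum>k<n. (e k)\<^sup>2) = 1 \<Longrightarrow>
      distributed M lborel (\<lambda>w. \<Sum>k<n. e k * X k w) std_normal_density"
    and diff_normal: "\<And>e. (\<Sum>k<n. (e k)\<^sup>2) = 1 \<Longrightarrow>
      distributed M lborel (\<lambda>w. \<Sum>k<n. e k * (X k w - Y k w)) (normal_density 0 (sqrt (2 * \<kappa>)))"
    and same_law: "distr M (Pi\<^sub>M {..<n} (\<lambda>_. borel)) (\<lambda>w. \<lambda>k\<in>{..<n}. X k w) =
      distr M (Pi\<^sub>M {..<n} (\<lambda>_. borel)) (\<lambda>w. \<lambda>k\<in>{..<n}. Y k w)"
begin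

abbreviation "\<xi> \<equiv> (\<lambda>w. \<lambda>k\<in>{..<n}. X k w)"
abbreviation "\<eta> \<equiv> (\<lambda>w. \<lambda>k\<in>{..<n}. Y k w)"
abbreviation "P \<equiv> (Pi\<^sub>M {..<n} (\<lambda>_. borel :: real measure))"

lemma xi_measurable [measurable]: "\<xi> \<in> measurable M P"
  by (intro measurable_restrict X_measurable) auto

lemma eta_measurable [measurable]: "\<eta> \<in> measurable M P"
  by (intro measurable_restrict Y_measurable) auto

lemma expectation_eta: 
  fixes h :: "(nat \<Rightarrow> real) \<Rightarrow> real"
  assumes [measurable]: "h \<in> borel_measurable P"
  shows "expectation (\<lambda>w. h (\<eta> w)) = expectation (\<lambda>w. h (\<xi> w))"
  using same_law integral_distr[of \<xi> M P h] integral_distr[of \<eta> M P h] by simp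

lemma integrable_eta_iff:
  fixes h :: "(nat \<Rightarrow> real) \<Rightarrow> real"
  assumes [measurable]: "h \<in> borel_measurable P"
  shows "integrable M (\<lambda>w. h (\<eta> w)) \<longleftrightarrow> integrable M (\<lambda>w. h (\<xi> w))"
  using same_law integrable_distr_eq[of \<xi> M P h] integrable_distr_eq[of \<eta> M P h] by simp

lemma X_coordinate_normal:
  assumes "k < n" shows "distributed M lborel (X k) std_normal_density"
proof -
  have "(\<Sum>j<n. ((if j = k then 1 else 0) :: real)\<^sup>2) = 1"
    using assms by (simp add: if_distrib[of "\<lambda>x. x\<^sup>2"] cong: if_cong)
  from X_normal[OF this] show ?thesis using assms by (simp add: if_distrib[of "\<lambda>x. x * _"] cong: if_cong)
qed

lemma integrable_bounded:
  fixes h :: "'a \<Rightarrow> real"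
  assumes "h \<in> borel_measurable M" "\<And>w. \<bar>h w\<bar> \<le> B"
  shows "integrable M h"
  using assms by (intro integrable_const_bound[of _ B]) auto

declare X_measurable [measurable] Y_measurable [measurable]

lemma integrable_X: "l < n \<Longrightarrow> integrable M (X l)"
  using normal_moments(1)[OF X_coordinate_normal] by simp

lemma integrable_mult_X:
  fixes h :: "(nat \<Rightarrow> real) \<Rightarrow> real"
  assumes "l < n" and [measurable]: "h \<in> borel_measurable P" and "\<And>z. \<bar>h z\<bar> \<le> B"
  shows "integrable M (\<lambda>w. h (\<xi> w) * X l w)"
proof (rule Bochner_Integration.integrable_bound[OF integrable_mult_right[OF integrable_X[OF assms(1)], of B]])
  show "(\<lambda>w. h (\<xi> w) * X l w) \<in> borel_measurable M" using assms(1) by measurable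
  show "AE w in M. norm (h (\<xi> w) * X l w) \<le> norm (B * X l w)"
    using order_trans[OF assms(3) abs_ge_self] by (auto simp: abs_mult intro!: mult_right_mono)
qed

text \<open>The last term is the symmetrised noise operator, so that \<open>dr_form\<close> is symmetric. Its weight \<open>1 / 50\<close>
  is small enough for \<open>1 / 10 \<le> lambda_star - 2 / 50\<close>: in \<open>dr_form_sign_le\<close> a point at which \<open>U\<close> and
  the direction \<open>dot\<close> have incompatible signs costs more than it can gain.\<close>

definition dr_form :: "((nat \<Rightarrow> real) \<Rightarrow> real) \<Rightarrow> ((nat \<Rightarrow> real) \<Rightarrow> real) \<Rightarrow> real" where
  "dr_form f g =
    (\<Sum>l<n. expectation (\<lambda>w. f (\<xi> w) * X l w) * expectation (\<lambda>w. g (\<xi> w) * X l w))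
      - (lambda_star - 1 / 50) * expectation (\<lambda>w. f (\<xi> w) * g (\<xi> w))
      - 1 / 100 * expectation (\<lambda>w. f (\<xi> w) * g (\<eta> w) + f (\<eta> w) * g (\<xi> w))"

text \<open>The form is controlled by three numbers: the norm \<open>a\<close> of the linear part of
  \<open>U\<close>, the mass \<open>s\<close> of its support, and the probability \<open>p\<close>
  that \<open>U\<close> changes sign between \<xi> and \<eta>. The linear part of \<open>V\<close>
  and the product of \<open>V\<close> with itself only matter through their signs.\<close>

theorem dr_form_sign_le:
  fixes f g :: "(nat \<Rightarrow> real) \<Rightarrow> real"
  assumes f [measurable]: "f \<in> borel_measurable P" and g [measurable]: "g \<in> borel_measurable P"
    and f1: "\<And>z. f z = 1 \<or> f z = -1" and g1: "\<And>z. g z = 1 \<or> g z = -1"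
  shows "dr_form f g \<le> (1 - lambda_star) * (4 * (std_normal_density C_star)\<^sup>2) + 300 * \<kappa>\<^sup>2"
proof -
  let ?F = "(1 - lambda_star) * (4 * (std_normal_density C_star)\<^sup>2)"
  let ?S = "\<Sum>l<n. expectation (\<lambda>w. f (\<xi> w) * X l w) * expectation (\<lambda>w. g (\<xi> w) * X l w)"
  let ?I = "expectation (\<lambda>w. f (\<xi> w) * g (\<xi> w))"
  let ?T = "expectation (\<lambda>w. f (\<xi> w) * g (\<eta> w) + f (\<eta> w) * g (\<xi> w))"
  define U V where "U z = (f z + g z) / 2" and "V z = (f z - g z) / 2" for z
  have [measurable]: "U \<in> borel_measurable P" "V \<in> borel_measurable P"
    unfolding U_def V_def by measurable
  have UV: "f z = U z + V z" "g z = U z - V z" for z by (auto simp: U_def V_def field_simps)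
  have UV_cases: "U z = 1 \<and> V z = 0 \<or> U z = -1 \<and> V z = 0 \<or> U z = 0 \<and> V z = 1 \<or> U z = 0 \<and> V z = -1" for z
    using f1[of z] g1[of z] by (auto simp: U_def V_def)
  have U1: "\<bar>U z\<bar> \<le> 1" and V1: "\<bar>V z\<bar> \<le> 1" for z using UV_cases[of z] by auto
  define b where "b l = expectation (\<lambda>w. U (\<xi> w) * X l w)" for l
  define c where "c l = expectation (\<lambda>w. V (\<xi> w) * X l w)" for l
  define s where "s = expectation (\<lambda>w. \<bar>U (\<xi> w)\<bar>)"
  define p where "p = expectation (\<lambda>w. if U (\<xi> w) * U (\<eta> w) = -1 then 1 else 0 :: real)"
  define a where "a = sqrt (\<Sum>l<n. (b l)\<^sup>2)"
  have a0: "0 \<le> a" by (simp add: a_def sum_nonneg)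
  have a2: "a\<^sup>2 = (\<Sum>l<n. (b l)\<^sup>2)" by (simp add: a_def sum_nonneg)
  have S: "?S \<le> a\<^sup>2"
  proof -
    have "?S = (\<Sum>l<n. (b l + c l) * (b l - c l))"
    proof (rule sum.cong[OF refl])
      fix l assume "l \<in> {..<n}"
      then have "integrable M (\<lambda>w. U (\<xi> w) * X l w)" "integrable M (\<lambda>w. V (\<xi> w) * X l w)"
        using U1 V1 by (auto intro!: integrable_mult_X[where B=1])
      then show "expectation (\<lambda>w. f (\<xi> w) * X l w) * expectation (\<lambda>w. g (\<xi> w) * X l w) = (b l + c l) * (b l - c l)"
        unfolding UV b_def c_def by (simp add: ring_distribs)
    qed
    \<comment> \<open>Each summand is \<open>(b l)\<^sup>2 - (c l)\<^sup>2\<close>, so the linear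
      part of \<open>V\<close> can only lower the form.\<close>
    also have "\<dots> \<le> (\<Sum>l<n. (b l)\<^sup>2)"
      by (intro sum_mono) (simp add: algebra_simps power2_eq_square)
    finally show ?thesis by (simp add: a2)
  qed
  have sint: "integrable M (\<lambda>w. \<bar>U (\<xi> w)\<bar>)" "integrable M (\<lambda>w. \<bar>U (\<eta> w)\<bar>)"
    using U1 by (auto intro!: integrable_bounded[of _ 1])
  have pint: "integrable M (\<lambda>w. if U (\<xi> w) * U (\<eta> w) = -1 then 1 else 0 :: real)"
    by (intro integrable_bounded[of _ 1]) auto
  have s': "expectation (\<lambda>w. \<bar>U (\<eta> w)\<bar>) = s"
    unfolding s_def by (rule expectation_eta[of "\<lambda>z. \<bar>U z\<bar>"]) measurable
  have I: "?I = 2 * s - 1"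
  proof -
    have "?I = expectation (\<lambda>w. 2 * \<bar>U (\<xi> w)\<bar> - 1)"
    proof (rule Bochner_Integration.integral_cong[OF refl])
      fix w show "f (\<xi> w) * g (\<xi> w) = 2 * \<bar>U (\<xi> w)\<bar> - 1"
        using UV_cases[of "\<xi> w"] unfolding UV by auto
    qed
    also have "\<dots> = 2 * s - 1" using sint by (simp add: s_def prob_space)
    finally show ?thesis .
  qed
  \<comment> \<open>\<open>U U' - V V' \<ge> \<bar>U\<bar> + \<bar>U'\<bar> - 1\<close> except where \<open>U\<close> and \<open>U'\<close> are nonzero of opposite signs.\<close>
  have T: "2 * (2 * s - 1 - 2 * p) \<le> ?T"
  proof -
    have "2 * (2 * s - 1 - 2 * p) = expectation (\<lambda>w. 2 * (\<bar>U (\<xi> w)\<bar> + \<bar>U (\<eta> w)\<bar> - 1 -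
        2 * (if U (\<xi> w) * U (\<eta> w) = -1 then 1 else 0)))"
      using sint pint by (simp add: s' p_def prob_space) (simp add: s_def)
    also have "\<dots> \<le> ?T"
    proof (rule integral_mono)
      have "\<bar>f (\<xi> w) * g (\<eta> w) + f (\<eta> w) * g (\<xi> w)\<bar> \<le> 2" for w
        using f1[of "\<xi> w"] g1[of "\<eta> w"] f1[of "\<eta> w"] g1[of "\<xi> w"] by auto
      then show "integrable M (\<lambda>w. f (\<xi> w) * g (\<eta> w) + f (\<eta> w) * g (\<xi> w))"
        by (intro integrable_bounded[of _ 2]) auto
      show "2 * (\<bar>U (\<xi> w)\<bar> + \<bar>U (\<eta> w)\<bar> - 1 - 2 * (if U (\<xi> w) * U (\<eta> w) = -1 then 1 else 0))
        \<le> f (\<xi> w) * g (\<eta> w) + f (\<eta> w) * g (\<xi> w)" for w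
        using UV_cases[of "\<xi> w"] UV_cases[of "\<eta> w"] unfolding UV by (elim disjE conjE) simp_all
    qed (use sint pint in auto)
    finally show ?thesis .
  qed
  have main: "dr_form f g \<le> a\<^sup>2 - lambda_star * (2 * s - 1) + p / 25"
  proof -
    \<comment> \<open>The identity and noise terms both carry 2 s - 1, with weights
      \<open>lambda_star - 1 / 50\<close> and 1/50 that add up to \<open>lambda_star\<close>; the
      sign changes leave p / 25.\<close>
    have "(lambda_star - 1 / 50) * (2 * s - 1) = lambda_star * (2 * s - 1) - (2 * s - 1) / 50"
      by (simp add: left_diff_distrib)
    moreover have "S' - q' - 1 / 100 * T' \<le> a' - q + p / 25"
      if "S' \<le> a'" "2 * (2 * s - 1 - 2 * p) \<le> T'" "q' = q - (2 * s - 1) / 50" for S' T' a' q q' :: real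
      using that by (simp add: field_simps)
    ultimately show ?thesis using S T unfolding dr_form_def I by blast
  qed
  show ?thesis
  proof (cases "a < lambda_star")
    case True
    \<comment> \<open>A sign change needs U \<noteq> 0. Hence p / 25 \<le> s / 25, which the term -2
      \<open>lambda_star\<close> s absorbs.\<close>
    have "p \<le> s" unfolding p_def s_def
    proof (intro integral_mono pint sint)
      show "(if U (\<xi> w) * U (\<eta> w) = -1 then 1 else 0) \<le> \<bar>U (\<xi> w)\<bar>" for w
        using UV_cases[of "\<xi> w"] by (elim disjE conjE) simp_all
    qed
    moreover have "0 \<le> s" by (simp add: s_def)
    then have "15 / 100 * s \<le> lambda_star * s" by (intro mult_right_mono lambda_star_bounds)
    ultimately have "a\<^sup>2 - lambda_star * (2 * s - 1) + p / 25 \<le> a\<^sup>2 + lambda_star"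
      using \<open>0 \<le> s\<close> by (simp add: algebra_simps)
    also have "\<dots> \<le> ?F" using True a0 by (intro sq_add_lambda_star_le) auto
    finally show ?thesis using main by (smt (verit) zero_le_power2)
  next
    case False
    then have al: "lambda_star \<le> a" "0 < a" using lambda_star_bounds by auto
    \<comment> \<open>The unit direction of the linear part of \<open>U\<close>. Along it the
      problem becomes one-dimensional, because the mean of \<open>U\<close> times \<open>dot\<close>
      is the whole norm \<open>a\<close>.\<close>
    define e where "e l = b l / a" for l
    have e1: "(\<Sum>l<n. (e l)\<^sup>2) = 1"
    proof -
      have "(\<Sum>l<n. (e l)\<^sup>2) = a\<^sup>2 / a\<^sup>2"
        unfolding a2 by (simp add: e_def power_divide sum_divide_distrib[symmetric] a2)
      then show ?thesis using al by simp
    qed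
    define dot where "dot z = (\<Sum>l<n. e l * z l)" for z :: "nat \<Rightarrow> real"
    have [measurable]: "dot \<in> borel_measurable P" unfolding dot_def by measurable
    have dx: "dot (\<xi> w) = (\<Sum>l<n. e l * X l w)" and dy: "dot (\<eta> w) = (\<Sum>l<n. e l * Y l w)" for w
      by (simp_all add: dot_def)
    have N: "distributed M lborel (\<lambda>w. dot (\<xi> w)) std_normal_density"
      unfolding dx by (rule X_normal[OF e1])
    note mom = normal_moments[OF N zero_less_one]
    have EU: "expectation (\<lambda>w. U (\<xi> w) * dot (\<xi> w)) = a"
    proof -
      have "expectation (\<lambda>w. U (\<xi> w) * dot (\<xi> w)) = expectation (\<lambda>w. \<Sum>l<n. e l * (U (\<xi> w) * X l w))"
        unfolding dx by (intro Bochner_Integration.integral_cong) (auto simp: sum_distrib_left ac_simps)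
      also have "\<dots> = (\<Sum>l<n. e l * b l)"
        unfolding b_def using U1
        by (subst Bochner_Integration.integral_sum) (auto intro!: integrable_mult_right integrable_mult_X[where B=1])
      also have "\<dots> = a\<^sup>2 / a"
        unfolding a2 by (simp add: e_def power2_eq_square sum_divide_distrib[symmetric])
      also have "\<dots> = a" using al by (simp add: power2_eq_square)
      finally show ?thesis .
    qed
    have Uint: "integrable M (\<lambda>w. U (\<xi> w) * dot (\<xi> w))"
    proof (rule Bochner_Integration.integrable_bound[OF mom(1)])
      show "AE w in M. norm (U (\<xi> w) * dot (\<xi> w)) \<le> norm (dot (\<xi> w))"
        using U1 by (auto simp: abs_mult intro!: mult_left_le_one_le)
    qed measurable
    have a_le1: "a \<le> 1"
    proof -
      have "a \<le> expectation (\<lambda>w. (1 + (dot (\<xi> w))\<^sup>2) / 2)"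
        unfolding EU[symmetric]
      proof (rule integral_mono)
        fix w
        have "0 \<le> (U (\<xi> w) - dot (\<xi> w))\<^sup>2" by simp
        moreover have "(U (\<xi> w))\<^sup>2 \<le> 1" using U1 by (simp add: abs_square_le_1)
        ultimately show "U (\<xi> w) * dot (\<xi> w) \<le> (1 + (dot (\<xi> w))\<^sup>2) / 2"
          by (simp add: power2_eq_square algebra_simps)
      qed (use Uint mom in auto)
      also have "\<dots> = 1" using mom by (simp add: prob_space)
      finally show ?thesis .
    qed
    \<comment> \<open>\<open>J\<close> marks the points where \<open>U\<close> is nonzero but
      \<open>dot\<close> does not agree with its sign by the margin 1/10.\<close>
    define J where "J z = (if U z = 1 \<and> dot z < 1 / 10 then 1 else 0) +
      (if U z = -1 \<and> dot z > - (1 / 10) then 1 else 0 :: real)" for z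
    have [measurable]: "J \<in> borel_measurable P" unfolding J_def by measurable
    have J1: "\<bar>J z\<bar> \<le> 1" for z by (auto simp: J_def)
    have Jint: "integrable M (\<lambda>w. J (\<xi> w))" "integrable M (\<lambda>w. J (\<eta> w))"
      using J1 by (auto intro!: integrable_bounded[of _ 1])
    define j where "j = expectation (\<lambda>w. J (\<xi> w))"
    have j': "expectation (\<lambda>w. J (\<eta> w)) = j" unfolding j_def by (rule expectation_eta) measurable
    have kD: "distributed M lborel (\<lambda>w. dot (\<xi> w) - dot (\<eta> w)) (normal_density 0 (sqrt (2 * \<kappa>)))"
      using diff_normal[OF e1] by (simp add: dx dy sum_subtractf right_diff_distrib)
    \<comment> \<open>The difference has variance 2 \<kappa>, so its fourth moment 3 (2 \<kappa>)^2
      is of second order. A second moment would only give a loss of order \<kappa>, the same order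
      as the gain.\<close>
    have Dm: "integrable M (\<lambda>w. (dot (\<xi> w) - dot (\<eta> w)) ^ 4)"
      "expectation (\<lambda>w. (dot (\<xi> w) - dot (\<eta> w)) ^ 4) = 12 * \<kappa>\<^sup>2"
      using normal_moments(3,5)[OF kD] kappa_pos
      by (auto simp: power4_eq_xxxx power2_eq_square)
    \<comment> \<open>If \<open>U = 1\<close> and \<open>U' = -1\<close>, then \<open>x < 1/10\<close> or \<open>y > -1/10\<close> or \<open>x - y \<ge> 1/5\<close>; the last
      event is controlled by the fourth moment.\<close>
    have "p \<le> expectation (\<lambda>w. 625 * (dot (\<xi> w) - dot (\<eta> w)) ^ 4 + J (\<xi> w) + J (\<eta> w))"
      unfolding p_def
    proof (rule integral_mono)
      fix w
      let ?x = "dot (\<xi> w)" and ?y = "dot (\<eta> w)"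
      have 4: "1 \<le> 625 * d ^ 4" if "1 / 5 \<le> \<bar>d\<bar>" for d :: real
        using power_mono[OF that, of 4] by (simp add: power_divide)
      have "0 \<le> 625 * (?x - ?y) ^ 4" by simp
      moreover have "1 \<le> 625 * (?x - ?y) ^ 4" if "1 / 10 \<le> ?x" "?y \<le> - (1 / 10)"
        using that by (intro 4) linarith
      moreover have "1 \<le> 625 * (?x - ?y) ^ 4" if "1 / 10 \<le> ?y" "?x \<le> - (1 / 10)"
        using that by (intro 4) linarith
      ultimately show "(if U (\<xi> w) * U (\<eta> w) = -1 then 1 else 0)
          \<le> 625 * (?x - ?y) ^ 4 + J (\<xi> w) + J (\<eta> w)"
        using UV_cases[of "\<xi> w"] UV_cases[of "\<eta> w"]
        unfolding J_def by (elim disjE conjE) (simp_all add: not_less)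
    qed (use pint Dm Jint in auto)
    also have "\<dots> = 7500 * \<kappa>\<^sup>2 + 2 * j"
      using Dm Jint by (simp add: j' j_def[symmetric])
    finally have p: "p \<le> 7500 * \<kappa>\<^sup>2 + 2 * j" .
    have m1: "(- dot (\<xi> w)) = (\<Sum>l<n. (- e l) * X l w)" for w by (simp add: dx sum_negf)
    have N': "distributed M lborel (\<lambda>w. - dot (\<xi> w)) std_normal_density"
      unfolding m1 by (rule X_normal) (simp add: e1)
    let ?H = "a * std_normal_density (lambda_star / a) - lambda_star * std_normal_cdf (- (lambda_star / a))"
    have tail: "integrable M (\<lambda>w. max 0 (a * Z w - lambda_star))"
      "expectation (\<lambda>w. max 0 (a * Z w - lambda_star)) = ?H"
      if "distributed M lborel Z std_normal_density" for Z
      using has_bochner_integral_std_normal_positive_part[of a lambda_star] al lambda_star_bounds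
        distributed_integrable[OF that, of "\<lambda>x. max 0 (a * x - lambda_star)"]
        distributed_integral[OF that, of "\<lambda>x. max 0 (a * x - lambda_star)"]
      by (auto simp: has_bochner_integral_iff)
    \<comment> \<open>The right-hand integrand below is the maximum of a u x -
      \<open>lambda_star\<close> |u| over u in {-1, 0, 1}. The extra J / 25 fits because at a marked
      point the left integrand is at most 1/10 - 15/100 + 1/25 < 0. Doubling the inequality and
      subtracting a^2 gives the dual value.\<close>
    have "a * a - lambda_star * s + j / 25 =
        expectation (\<lambda>w. a * (U (\<xi> w) * dot (\<xi> w)) - lambda_star * \<bar>U (\<xi> w)\<bar> + J (\<xi> w) / 25)"
      using Uint sint Jint by (simp add: EU s_def j_def)
    also have "\<dots> \<le> expectation (\<lambda>w. max 0 (a * dot (\<xi> w) - lambda_star) + max 0 (a * (- dot (\<xi> w)) - lambda_star))"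
    proof (rule integral_mono)
      fix w
      let ?x = "dot (\<xi> w)"
      have "a * ?x \<le> 1 / 10" if "?x < 1 / 10"
        using mult_left_mono[of ?x "1 / 10" a] that a_le1 al by linarith
      moreover have "- (1 / 10) \<le> a * ?x" if "- (1 / 10) < ?x"
        using mult_left_mono[of "- (1 / 10)" ?x a] that a_le1 al by linarith
      ultimately show "a * (U (\<xi> w) * ?x) - lambda_star * \<bar>U (\<xi> w)\<bar> + J (\<xi> w) / 25
          \<le> max 0 (a * ?x - lambda_star) + max 0 (a * (- ?x) - lambda_star)"
        using UV_cases[of "\<xi> w"] lambda_star_bounds
        unfolding J_def max_def by (elim disjE conjE) (auto split: if_splits)
    qed (use Uint sint Jint tail[OF N] tail[OF N'] in auto)
    also have "\<dots> = 2 * ?H" using tail[OF N] tail[OF N'] by simp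
    finally have "a\<^sup>2 - lambda_star * (2 * s - 1) + p / 25 \<le> davie_reeds_dual lambda_star a + 300 * \<kappa>\<^sup>2"
      using p by (simp add: davie_reeds_dual_def power2_eq_square algebra_simps)
    also have "\<dots> \<le> ?F + 300 * \<kappa>\<^sup>2"
      using davie_reeds_dual_lambda_star_le[OF al(1)] by simp
    finally show ?thesis using main by linarith
  qed
qed

end

section \<open>The bound for unit vectors\<close>

context coupled_gaussian_vectors
begin

section \<open>Moments of the coordinates and concentration of the norm\<close>

lemma X_moments:
  assumes "l < n"
  shows "expectation (X l) = 0" "integrable M (\<lambda>w. (X l w)\<^sup>2)" "expectation (\<lambda>w. (X l w)\<^sup>2) = 1"
    "integrable M (\<lambda>w. (X l w) ^ 4)" "expectation (\<lambda>w. (X l w) ^ 4) = 3"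
  using normal_moments(2-)[OF X_coordinate_normal[OF assms] zero_less_one]
    standard_normal_distributed_expectation[OF X_coordinate_normal[OF assms]] by simp_all

lemma diff_moment:
  assumes "l < n"
  shows "integrable M (\<lambda>w. (X l w - Y l w)\<^sup>2)" "expectation (\<lambda>w. (X l w - Y l w)\<^sup>2) = 2 * \<kappa>"
proof -
  have "(\<Sum>j<n. ((if j = l then 1 else 0) :: real)\<^sup>2) = 1"
    using assms by (simp add: if_distrib[of "\<lambda>x. x\<^sup>2"] cong: if_cong)
  from diff_normal[OF this] have "distributed M lborel (\<lambda>w. X l w - Y l w) (normal_density 0 (sqrt (2 * \<kappa>)))"
    using assms by (simp add: if_distrib[of "\<lambda>x. x * _"] cong: if_cong)
  from normal_moments(2,4)[OF this] kappa_pos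
  show "integrable M (\<lambda>w. (X l w - Y l w)\<^sup>2)" "expectation (\<lambda>w. (X l w - Y l w)\<^sup>2) = 2 * \<kappa>" by auto
qed

text \<open>Polarisation: \<open>12 x\<^sup>2 y\<^sup>2 = (x + y)\<^sup>4 + (x - y)\<^sup>4 - 2 x\<^sup>4 - 2 y\<^sup>4\<close>.\<close>

lemma mixed_fourth_moment:
  assumes k: "k < n" and l: "l < n" and kl: "k \<noteq> l"
  shows "integrable M (\<lambda>w. (X k w)\<^sup>2 * (X l w)\<^sup>2)" "expectation (\<lambda>w. (X k w)\<^sup>2 * (X l w)\<^sup>2) = 1"
proof -
  \<comment> \<open>Laws are assumed for unit linear forms, hence the factor 1 / sqrt 2. Each of
    these forms has fourth moment 3.\<close>
  have N: "distributed M lborel (\<lambda>w. (X k w + s * X l w) / sqrt 2) std_normal_density" if s: "s\<^sup>2 = 1" for s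
  proof -
    define e where "e j = (if j = k then 1 / sqrt 2 else 0) + (if j = l then s / sqrt 2 else 0)" for j
    have e2: "(e j)\<^sup>2 = (if j = k then 1 / 2 else 0) + (if j = l then 1 / 2 else 0)" for j
      using kl s by (auto simp: e_def power_divide)
    have "(\<Sum>j<n. (e j)\<^sup>2) = 1"
      using k l by (simp add: e2 sum.distrib)
    from X_normal[OF this] show ?thesis
      using k l by (simp add: e_def sum.distrib distrib_right if_distrib[of "\<lambda>x. x * _"] add_divide_distrib cong: if_cong)
  qed
  note p = normal_moments(3,5)[OF N[of 1] zero_less_one] and m = normal_moments(3,5)[OF N[of "-1"] zero_less_one]
  have eq: "(X k w)\<^sup>2 * (X l w)\<^sup>2 = (((X k w + 1 * X l w) / sqrt 2) ^ 4 * 4 + ((X k w + (-1) * X l w) / sqrt 2) ^ 4 * 4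
      - 2 * (X k w) ^ 4 - 2 * (X l w) ^ 4) / 12" for w
  proof -
    have "(x\<^sup>2 * y\<^sup>2) = ((x + 1 * y) ^ 4 + (x + (-1) * y) ^ 4 - 2 * x ^ 4 - 2 * y ^ 4) / 12" for x y :: real
      by (simp add: power4_eq_xxxx power2_eq_square algebra_simps)
    moreover have "(z / sqrt 2) ^ 4 * 4 = z ^ 4" for z
      by (simp add: power_divide power4_eq_xxxx)
    ultimately show ?thesis by metis
  qed
  show "integrable M (\<lambda>w. (X k w)\<^sup>2 * (X l w)\<^sup>2)"
    unfolding eq using p m X_moments(4)[OF k] X_moments(4)[OF l] by simp
  show "expectation (\<lambda>w. (X k w)\<^sup>2 * (X l w)\<^sup>2) = 1"
    unfolding eq using p m X_moments(4,5)[OF k] X_moments(4,5)[OF l] by simp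
qed

text \<open>The squares of distinct coordinates are uncorrelated and each has variance 3 - 1 = 2, so
  only the diagonal of the double sum survives. Thus \<open>X / sqrt n\<close> is nearly a unit
  vector for large \<open>n\<close>.\<close>

lemma sum_squares_concentration:
  shows "integrable M (\<lambda>w. ((\<Sum>k<n. (X k w)\<^sup>2) / n - 1)\<^sup>2)"
    and "expectation (\<lambda>w. ((\<Sum>k<n. (X k w)\<^sup>2) / n - 1)\<^sup>2) = 2 / n"
proof -
  have eq: "((\<Sum>k<n. (X k w)\<^sup>2) / n - 1)\<^sup>2 = (\<Sum>k<n. \<Sum>l<n. ((X k w)\<^sup>2 - 1) * ((X l w)\<^sup>2 - 1)) / n\<^sup>2" for w
  proof -
    have "(\<Sum>k<n. (X k w)\<^sup>2) / n - 1 = (\<Sum>k<n. (X k w)\<^sup>2 - 1) / n"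
      using n_pos by (simp add: sum_subtractf field_simps)
    then show ?thesis by (simp add: power2_eq_square sum_product)
  qed
  have *: "integrable M (\<lambda>w. ((X k w)\<^sup>2 - 1) * ((X l w)\<^sup>2 - 1)) \<and>
      expectation (\<lambda>w. ((X k w)\<^sup>2 - 1) * ((X l w)\<^sup>2 - 1)) = (if k = l then 2 else 0)"
    if "k < n" "l < n" for k l
  proof -
    have e: "((X k w)\<^sup>2 - 1) * ((X l w)\<^sup>2 - 1) = (X k w)\<^sup>2 * (X l w)\<^sup>2 - (X k w)\<^sup>2 - (X l w)\<^sup>2 + 1" for w
      by (simp add: algebra_simps)
    note m = X_moments(2-5)[OF that(1)] X_moments(2-5)[OF that(2)]
    show ?thesis
    proof (cases "k = l")
      case True
      have "(X l w)\<^sup>2 * (X l w)\<^sup>2 = (X l w) ^ 4" for w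
        by (simp add: power4_eq_xxxx power2_eq_square)
      then show ?thesis unfolding e using m True by (simp add: prob_space)
    next
      case False
      then show ?thesis unfolding e using m mixed_fourth_moment[OF that False] by (simp add: prob_space)
    qed
  qed
  show "integrable M (\<lambda>w. ((\<Sum>k<n. (X k w)\<^sup>2) / n - 1)\<^sup>2)"
    unfolding eq using * by (intro integrable_divide Bochner_Integration.integrable_sum) auto
  have "expectation (\<lambda>w. ((\<Sum>k<n. (X k w)\<^sup>2) / n - 1)\<^sup>2) = (\<Sum>k<n. \<Sum>l<n. if k = l then 2 else 0) / n\<^sup>2"
  proof -
    have "expectation (\<lambda>w. \<Sum>k<n. \<Sum>l<n. ((X k w)\<^sup>2 - 1) * ((X l w)\<^sup>2 - 1)) =
        (\<Sum>k<n. \<Sum>l<n. expectation (\<lambda>w. ((X k w)\<^sup>2 - 1) * ((X l w)\<^sup>2 - 1)))"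
      using * by (subst Bochner_Integration.integral_sum Bochner_Integration.integral_sum[symmetric];
        auto intro!: Bochner_Integration.integrable_sum sum.cong Bochner_Integration.integral_sum)
    also have "\<dots> = (\<Sum>k<n. \<Sum>l<n. if k = l then 2 else 0)"
      using * by (intro sum.cong refl) simp
    finally show ?thesis unfolding eq by simp
  qed
  also have "\<dots> = 2 / n" using n_pos by (simp add: power2_eq_square)
  finally show "expectation (\<lambda>w. ((\<Sum>k<n. (X k w)\<^sup>2) / n - 1)\<^sup>2) = 2 / n" .
qed

text \<open>The linear part is at least 1 - \<epsilon>, the identity part is 1, and the noise part
  is at most 1 - \<kappa>/2 + 2 \<epsilon>. The weights 1, \<open>lambda_star - 1 / 50\<close> and
  1/50 combine these to the claim.\<close>

theorem dr_form_unit_vectors_ge: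
  fixes F :: "nat \<Rightarrow> (nat \<Rightarrow> real) \<Rightarrow> real"
  assumes F [measurable]: "\<And>k. k < n \<Longrightarrow> F k \<in> borel_measurable P"
    and F1: "\<And>z. (\<Sum>k<n. (F k z)\<^sup>2) = 1"
    and eps: "expectation (\<lambda>w. \<Sum>k<n. (F k (\<xi> w) - X k w / sqrt n)\<^sup>2) \<le> \<epsilon>"
  shows "(\<Sum>k<n. dr_form (F k) (F k)) \<ge> 1 - lambda_star + \<kappa> / 100 - 2 * \<epsilon>"
proof -
  let ?r = "sqrt (real n)"
  have Fb: "\<bar>F k z\<bar> \<le> 1" if "k < n" for k z
  proof -
    have "(F k z)\<^sup>2 \<le> (\<Sum>k<n. (F k z)\<^sup>2)" using that by (intro member_le_sum) auto
    then show ?thesis using F1 by (simp add: abs_square_le_1)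
  qed
  note FX = integrable_mult_X[OF _ F Fb]
  have FF1: "\<bar>F k y * F k z\<bar> \<le> 1" if "k < n" for k y z
    using mult_mono[OF Fb[OF that, of y] Fb[OF that, of z]] by (simp add: abs_mult)
  have FF: "integrable M (\<lambda>w. F k (\<xi> w) * F k (\<xi> w))" "integrable M (\<lambda>w. F k (\<xi> w) * F k (\<eta> w))" if "k < n" for k
    using that by (intro integrable_bounded[of _ 1] FF1; measurable)+
  have Fd: "integrable M (\<lambda>w. (F k (\<xi> w) - X k w / ?r)\<^sup>2)" if "k < n" for k
    using FX[OF that that that] FF(1)[OF that] X_moments(2)[OF that]
    by (simp add: power2_diff power_divide power2_eq_square[of "F k _"] mult.assoc)
  have "1 - \<epsilon> \<le> (\<Sum>k<n. \<Sum>l<n. (expectation (\<lambda>w. F k (\<xi> w) * X l w))\<^sup>2)"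
  proof -
    have "(\<Sum>k<n. expectation (\<lambda>w. (F k (\<xi> w) - X k w / ?r)\<^sup>2)) \<le> \<epsilon>"
      using eps Fd by (simp add: Bochner_Integration.integral_sum)
    moreover have "expectation (\<lambda>w. (F k (\<xi> w) - X k w / ?r)\<^sup>2) =
        expectation (\<lambda>w. (F k (\<xi> w))\<^sup>2) - 2 / ?r * expectation (\<lambda>w. F k (\<xi> w) * X k w) + 1 / n"
      if "k < n" for k
    proof -
      have "(F k (\<xi> w) - X k w / ?r)\<^sup>2 = F k (\<xi> w) * F k (\<xi> w) - 2 / ?r * (F k (\<xi> w) * X k w) + (X k w)\<^sup>2 / n" for w
        by (simp add: power2_diff power_divide power2_eq_square[of "F k _"])
      then show ?thesis
        using FX[OF that that that] FF(1)[OF that] X_moments(2,3)[OF that]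
        by (simp add: power2_eq_square[of "F k _"])
    qed
    moreover have "(\<Sum>k<n. expectation (\<lambda>w. (F k (\<xi> w))\<^sup>2)) = 1"
      using FF(1) F1 by (subst Bochner_Integration.integral_sum[symmetric])
        (auto simp: power2_eq_square[symmetric] prob_space)
    ultimately have 1: "1 - \<epsilon> \<le> (\<Sum>k<n. 2 / ?r * expectation (\<lambda>w. F k (\<xi> w) * X k w) - 1 / n)"
      using n_pos by (simp add: sum.distrib sum_subtractf)
    \<comment> \<open>Completing the square turns closeness to \<open>X / sqrt n\<close> into a
      lower bound on the diagonal coefficients; the off-diagonal ones only add nonnegative
      terms.\<close>
    have "2 / ?r * t - 1 / n \<le> t\<^sup>2" for t
    proof -
      have "0 \<le> (t - 1 / ?r)\<^sup>2" by simp
      then show ?thesis by (simp add: power2_diff power_divide)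
    qed
    then have "(\<Sum>k<n. 2 / ?r * expectation (\<lambda>w. F k (\<xi> w) * X k w) - 1 / n) \<le>
        (\<Sum>k<n. (expectation (\<lambda>w. F k (\<xi> w) * X k w))\<^sup>2)"
      by (intro sum_mono)
    also have "\<dots> \<le> (\<Sum>k<n. \<Sum>l<n. (expectation (\<lambda>w. F k (\<xi> w) * X l w))\<^sup>2)"
      by (intro sum_mono member_le_sum) auto
    finally show ?thesis using 1 by linarith
  qed
  moreover have "(\<Sum>k<n. expectation (\<lambda>w. F k (\<xi> w) * F k (\<xi> w))) = 1"
    using FF(1) F1 by (subst Bochner_Integration.integral_sum[symmetric])
      (auto simp: power2_eq_square[symmetric] prob_space)
  moreover have "(\<Sum>k<n. expectation (\<lambda>w. F k (\<xi> w) * F k (\<eta> w))) \<le> 1 - \<kappa> / 2 + 2 * \<epsilon>"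
  proof -
    have "(\<lambda>z. (\<Sum>k<n. (F k z - z k / ?r)\<^sup>2)) \<in> borel_measurable P" by measurable
    from expectation_eta[OF this] have eps':
      "expectation (\<lambda>w. \<Sum>k<n. (F k (\<eta> w) - Y k w / ?r)\<^sup>2) = expectation (\<lambda>w. \<Sum>k<n. (F k (\<xi> w) - X k w / ?r)\<^sup>2)"
      by simp
    have Xd: "integrable M (\<lambda>w. \<Sum>k<n. (F k (\<xi> w) - X k w / ?r)\<^sup>2)"
      using Fd by (intro Bochner_Integration.integrable_sum) auto
    moreover have "(\<lambda>z. (\<Sum>k<n. (F k z - z k / ?r)\<^sup>2)) \<in> borel_measurable P" by measurable
    from integrable_eta_iff[OF this]
    have "integrable M (\<lambda>w. \<Sum>k<n. (F k (\<eta> w) - Y k w / ?r)\<^sup>2) \<longleftrightarrow>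
        integrable M (\<lambda>w. \<Sum>k<n. (F k (\<xi> w) - X k w / ?r)\<^sup>2)"
      by simp
    ultimately have Yd: "integrable M (\<lambda>w. \<Sum>k<n. (F k (\<eta> w) - Y k w / ?r)\<^sup>2)" by simp
    have FFs: "integrable M (\<lambda>w. \<Sum>k<n. F k (\<xi> w) * F k (\<eta> w))"
      using FF by (intro Bochner_Integration.integrable_sum) auto
    have dd: "(X k w / ?r - Y k w / ?r)\<^sup>2 = (X k w - Y k w)\<^sup>2 / n" for k w
      by (simp add: diff_divide_distrib[symmetric] power_divide)
    have XYd: "integrable M (\<lambda>w. \<Sum>k<n. (X k w / ?r - Y k w / ?r)\<^sup>2)"
      unfolding dd using diff_moment by (intro Bochner_Integration.integrable_sum integrable_divide) auto
    \<comment> \<open>The displacement of \<open>X / sqrt n\<close> is transferred to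
      \<open>F\<close>, whose displacement is 2 - 2 times the inner product because \<open>F\<close>
      has unit length. The factor 2 in front of this displacement costs half of the gain and leaves
      \<kappa>/2 instead of \<kappa>.\<close>
    have "2 * \<kappa> = expectation (\<lambda>w. \<Sum>k<n. (X k w / ?r - Y k w / ?r)\<^sup>2)"
      unfolding dd using diff_moment n_pos by (subst Bochner_Integration.integral_sum) auto
    also have "\<dots> \<le> expectation (\<lambda>w. 4 * (\<Sum>k<n. (F k (\<xi> w) - X k w / ?r)\<^sup>2) +
        4 * (\<Sum>k<n. (F k (\<eta> w) - Y k w / ?r)\<^sup>2) + (4 - 4 * (\<Sum>k<n. F k (\<xi> w) * F k (\<eta> w))))"
    proof (rule integral_mono)
      fix w
      have "(\<Sum>k<n. (X k w / ?r - Y k w / ?r)\<^sup>2) \<le> (\<Sum>k<n. 4 * (F k (\<xi> w) - X k w / ?r)\<^sup>2 +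
        4 * (F k (\<eta> w) - Y k w / ?r)\<^sup>2 + 2 * (F k (\<xi> w) - F k (\<eta> w))\<^sup>2)"
      proof (rule sum_mono)
        fix k
        have "(x - y)\<^sup>2 \<le> 4 * (f - x)\<^sup>2 + 4 * (g - y)\<^sup>2 + 2 * (f - g)\<^sup>2" for x y f g :: real
        proof -
          have "0 \<le> ((x - y) - 2 * (f - g))\<^sup>2" "0 \<le> ((f - x) + (g - y))\<^sup>2" by simp_all
          then show ?thesis by (simp add: power2_eq_square algebra_simps)
        qed
        then show "(X k w / ?r - Y k w / ?r)\<^sup>2 \<le> 4 * (F k (\<xi> w) - X k w / ?r)\<^sup>2 +
          4 * (F k (\<eta> w) - Y k w / ?r)\<^sup>2 + 2 * (F k (\<xi> w) - F k (\<eta> w))\<^sup>2" .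
      qed
      also have "\<dots> = 4 * (\<Sum>k<n. (F k (\<xi> w) - X k w / ?r)\<^sup>2) +
        4 * (\<Sum>k<n. (F k (\<eta> w) - Y k w / ?r)\<^sup>2) + 
        (2 * (\<Sum>k<n. (F k (\<xi> w))\<^sup>2) + 2 * (\<Sum>k<n. (F k (\<eta> w))\<^sup>2) - 4 * (\<Sum>k<n. F k (\<xi> w) * F k (\<eta> w)))"
        by (simp add: sum.distrib sum_distrib_left power2_diff[of "F _ (\<xi> w)" "F _ (\<eta> w)"] sum_subtractf algebra_simps)
      finally show "(\<Sum>k<n. (X k w / ?r - Y k w / ?r)\<^sup>2) \<le> 4 * (\<Sum>k<n. (F k (\<xi> w) - X k w / ?r)\<^sup>2) +
        4 * (\<Sum>k<n. (F k (\<eta> w) - Y k w / ?r)\<^sup>2) + (4 - 4 * (\<Sum>k<n. F k (\<xi> w) * F k (\<eta> w)))"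
        unfolding F1 by simp
    qed (use Xd Yd FFs XYd in auto)
    also have "\<dots> = 4 * expectation (\<lambda>w. \<Sum>k<n. (F k (\<xi> w) - X k w / ?r)\<^sup>2) +
        4 * expectation (\<lambda>w. \<Sum>k<n. (F k (\<eta> w) - Y k w / ?r)\<^sup>2) +
        (4 - 4 * (\<Sum>k<n. expectation (\<lambda>w. F k (\<xi> w) * F k (\<eta> w))))"
      using Xd Yd FFs FF(2) by (simp add: prob_space)
    finally show ?thesis using eps eps' by simp
  qed
  moreover have "(\<Sum>k<n. dr_form (F k) (F k)) =
    (\<Sum>k<n. \<Sum>l<n. (expectation (\<lambda>w. F k (\<xi> w) * X l w))\<^sup>2)
    - (lambda_star - 1 / 50) * (\<Sum>k<n. expectation (\<lambda>w. F k (\<xi> w) * F k (\<xi> w)))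
    - 1 / 50 * (\<Sum>k<n. expectation (\<lambda>w. F k (\<xi> w) * F k (\<eta> w)))"
  proof -
    have "F k (\<xi> w) * F k (\<eta> w) + F k (\<eta> w) * F k (\<xi> w) = 2 * (F k (\<xi> w) * F k (\<eta> w))" for k w
      by simp
    then show ?thesis
      unfolding dr_form_def
      by (simp add: sum_subtractf sum_distrib_left power2_eq_square)
  qed
  moreover have "0 \<le> expectation (\<lambda>w. \<Sum>k<n. (F k (\<xi> w) - X k w / ?r)\<^sup>2)"
    by (intro Bochner_Integration.integral_nonneg sum_nonneg) auto
  then have "0 \<le> \<epsilon>" using eps by linarith
  ultimately show ?thesis by simp
qed

end

section \<open>Discretisation\<close>

text \<open>Here \<open>m\<close> is both the inverse mesh and the cutoff. The value 0 beyond the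
  cutoff keeps the range finite.\<close>

definition round_trunc :: "nat \<Rightarrow> real \<Rightarrow> real" where
  "round_trunc m x = (if \<bar>x\<bar> \<le> m then \<lfloor>m * x\<rfloor> / m else 0)"

lemma finite_range_round_trunc: "finite (range (round_trunc m))"
proof (rule finite_subset)
  show "range (round_trunc m) \<subseteq> insert 0 ((\<lambda>j::int. j / m) ` {- int (m * m)..int (m * m)})"
  proof
    fix y assume "y \<in> range (round_trunc m)"
    then obtain x where y: "y = round_trunc m x" by blast
    show "y \<in> insert 0 ((\<lambda>j::int. j / m) ` {- int (m * m)..int (m * m)})"
    proof (cases "\<bar>x\<bar> \<le> m")
      case True
      have "\<bar>real m * x\<bar> \<le> real m * real m"
        using True by (simp add: abs_mult mult_left_mono)
      then have "- real (m * m) \<le> real m * x" "real m * x \<le> real (m * m)" by auto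
      then have "- int (m * m) \<le> \<lfloor>m * x\<rfloor>" "\<lfloor>m * x\<rfloor> \<le> int (m * m)"
        by (simp_all add: le_floor_iff floor_le_iff)
      then show ?thesis using True y by (auto simp: round_trunc_def)
    qed (use y in \<open>simp add: round_trunc_def\<close>)
  qed
qed auto

lemma round_trunc_measurable [measurable]: "round_trunc m \<in> borel_measurable borel"
  unfolding round_trunc_def by measurable

text \<open>Within the cutoff the error is at most the mesh 1/m; beyond it the error is x itself,
  and x^2 \<le> x^4 / m^2.\<close>

lemma round_trunc_error:
  assumes "0 < m"
  shows "(round_trunc m x - x)\<^sup>2 \<le> (1 + x ^ 4) / (real m)\<^sup>2"
proof (cases "\<bar>x\<bar> \<le> m")
  case True
  have "\<lfloor>m * x\<rfloor> \<le> m * x" "m * x \<le> \<lfloor>m * x\<rfloor> + 1" by linarith+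
  then have "\<bar>\<lfloor>m * x\<rfloor> - m * x\<bar> \<le> 1" by linarith
  then have "(\<lfloor>m * x\<rfloor> - m * x)\<^sup>2 \<le> 1" by (simp add: abs_square_le_1)
  moreover have "round_trunc m x - x = (\<lfloor>m * x\<rfloor> - m * x) / m"
    using True assms by (simp add: round_trunc_def field_simps)
  ultimately have "(round_trunc m x - x)\<^sup>2 \<le> 1 / (real m)\<^sup>2"
    by (simp add: power_divide divide_right_mono)
  also have "\<dots> \<le> (1 + x ^ 4) / (real m)\<^sup>2" by (intro divide_right_mono) auto
  finally show ?thesis .
next
  case False
  then have "(real m)\<^sup>2 \<le> x\<^sup>2" by (simp add: abs_le_square_iff[symmetric])
  then have "(real m)\<^sup>2 * x\<^sup>2 \<le> x\<^sup>2 * x\<^sup>2" by (intro mult_right_mono) auto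
  then have "x\<^sup>2 * (real m)\<^sup>2 \<le> 1 + x ^ 4" by (simp add: power4_eq_xxxx power2_eq_square mult_ac)
  then show ?thesis using False assms by (simp add: round_trunc_def pos_le_divide_eq)
qed

text \<open>Rounding can produce the zero vector, which is sent to the first basis vector so that
  the result has norm 1 whenever 0 < n.\<close>

definition unit_vector :: "nat \<Rightarrow> (nat \<Rightarrow> real) \<Rightarrow> nat \<Rightarrow> real" where
  "unit_vector n q k = (if (\<Sum>j<n. (q j)\<^sup>2) = 0 then (if k = 0 then 1 else 0)
     else q k / sqrt (\<Sum>j<n. (q j)\<^sup>2))"

lemma unit_vector_cong:
  assumes "\<And>j. j < n \<Longrightarrow> q j = q' j" "k < n"
  shows "unit_vector n q k = unit_vector n q' k"
proof -
  have "(\<Sum>j<n. (q j)\<^sup>2) = (\<Sum>j<n. (q' j)\<^sup>2)" using assms by (intro sum.cong) auto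
  then show ?thesis using assms by (simp add: unit_vector_def)
qed

lemma unit_vector_norm:
  assumes "0 < n"
  shows "(\<Sum>k<n. (unit_vector n q k)\<^sup>2) = 1"
proof (cases "(\<Sum>j<n. (q j)\<^sup>2) = 0")
  case True
  then show ?thesis using assms by (simp add: unit_vector_def if_distrib[of "\<lambda>x. x\<^sup>2"] cong: if_cong)
next
  case False
  moreover have "0 \<le> (\<Sum>j<n. (q j)\<^sup>2)" by (intro sum_nonneg) auto
  ultimately show ?thesis
    by (simp add: unit_vector_def power_divide sum_divide_distrib[symmetric])
qed

text \<open>After scaling by 1 / sqrt n, normalising \<open>W\<close> moves it by |1 - w|, and w
  differs from g by at most the distance of \<open>W\<close> and \<open>G\<close>. Two uses of (a -
  b)^2 \<le> 2 (a - c)^2 + 2 (c - b)^2 produce the factors 6 = 2 + 2 * 2 and 4 = 2 * 2.\<close>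

lemma unit_vector_dist:
  assumes n: "0 < n"
  shows "(\<Sum>k<n. (unit_vector n q k - x k / sqrt n)\<^sup>2) \<le>
    6 * (\<Sum>k<n. (q k - x k)\<^sup>2) / n + 4 * ((\<Sum>k<n. (x k)\<^sup>2) / n - 1)\<^sup>2"
proof -
  define W G where "W k = q k / sqrt n" and "G k = x k / sqrt n" for k
  define w g where "w = L2_set W {..<n}" and "g = L2_set G {..<n}"
  have w2: "w\<^sup>2 = (\<Sum>k<n. (W k)\<^sup>2)" and g2: "g\<^sup>2 = (\<Sum>k<n. (G k)\<^sup>2)"
    by (simp_all add: w_def g_def L2_set_def sum_nonneg)
  have w0: "0 \<le> w" "0 \<le> g" by (simp_all add: w_def g_def)
  have qs: "(\<Sum>j<n. (q j)\<^sup>2) = n * w\<^sup>2"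
    using n by (simp add: w2 W_def power_divide sum_divide_distrib[symmetric])
  \<comment> \<open>The formula also holds for w = 0, since the default value is a unit
    vector.\<close>
  have uW: "(\<Sum>k<n. (unit_vector n q k - W k)\<^sup>2) = (1 - w)\<^sup>2"
  proof (cases "w = 0")
    case True
    then have "\<forall>k<n. W k = 0" using w2 by (simp add: sum_nonneg_eq_0_iff)
    then show ?thesis using unit_vector_norm[OF n, of q] True by simp
  next
    case False
    have "unit_vector n q k = W k / w" for k
      using False n w0 by (simp add: unit_vector_def qs real_sqrt_mult W_def)
    then have "(\<Sum>k<n. (unit_vector n q k - W k)\<^sup>2) = (\<Sum>k<n. (1 / w - 1)\<^sup>2 * (W k)\<^sup>2)"
      by (intro sum.cong) (auto simp: power_mult_distrib[symmetric] algebra_simps)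
    also have "\<dots> = ((1 / w - 1) * w)\<^sup>2"
      by (simp add: sum_distrib_left[symmetric] w2 power_mult_distrib)
    also have "(1 / w - 1) * w = 1 - w" using False by (simp add: field_simps)
    finally show ?thesis .
  qed
  have wg: "\<bar>w - g\<bar> \<le> L2_set (\<lambda>k. W k - G k) {..<n}"
    using L2_set_triangle_ineq[of "\<lambda>k. W k - G k" G "{..<n}"]
      L2_set_triangle_ineq[of "\<lambda>k. G k - W k" W "{..<n}"]
    by (simp add: w_def g_def L2_set_def power2_commute[of "G _" "W _"] abs_le_iff)
  then have "(w - g)\<^sup>2 \<le> (L2_set (\<lambda>k. W k - G k) {..<n})\<^sup>2"
    by (metis abs_ge_zero power2_abs power_mono)
  also have "\<dots> = (\<Sum>k<n. (W k - G k)\<^sup>2)" by (simp add: L2_set_def sum_nonneg)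
  finally have wg2: "(w - g)\<^sup>2 \<le> (\<Sum>k<n. (W k - G k)\<^sup>2)" .
  \<comment> \<open>Since g + 1 \<ge> 1, the norm may be replaced by its square, whose mean square
    deviation is known exactly.\<close>
  have g1: "(g - 1)\<^sup>2 \<le> (g\<^sup>2 - 1)\<^sup>2"
  proof -
    have "(g - 1)\<^sup>2 * 1 \<le> (g - 1)\<^sup>2 * (g + 1)\<^sup>2"
      using w0 by (intro mult_left_mono) (auto simp: one_le_power)
    also have "\<dots> = (g\<^sup>2 - 1)\<^sup>2" by (simp add: power2_eq_square algebra_simps)
    finally show ?thesis by simp
  qed
  have sq: "(a - b)\<^sup>2 \<le> 2 * (a - c)\<^sup>2 + 2 * (c - b)\<^sup>2" for a b c :: real
  proof -
    have "0 \<le> ((a - c) - (c - b))\<^sup>2" by simp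
    then show ?thesis by (simp add: power2_eq_square algebra_simps)
  qed
  have "(\<Sum>k<n. (unit_vector n q k - G k)\<^sup>2) \<le> (\<Sum>k<n. 2 * (unit_vector n q k - W k)\<^sup>2 + 2 * (W k - G k)\<^sup>2)"
    by (intro sum_mono sq)
  also have "\<dots> = 2 * (1 - w)\<^sup>2 + 2 * (\<Sum>k<n. (W k - G k)\<^sup>2)"
    by (simp add: sum.distrib sum_distrib_left[symmetric] uW)
  also have "(1 - w)\<^sup>2 \<le> 2 * (\<Sum>k<n. (W k - G k)\<^sup>2) + 2 * (g\<^sup>2 - 1)\<^sup>2"
    using sq[of 1 w g] wg2 g1 by (simp add: power2_commute)
  finally have "(\<Sum>k<n. (unit_vector n q k - G k)\<^sup>2) \<le> 6 * (\<Sum>k<n. (W k - G k)\<^sup>2) + 4 * (g\<^sup>2 - 1)\<^sup>2"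
    by simp
  also have "(\<Sum>k<n. (W k - G k)\<^sup>2) = (\<Sum>k<n. (q k - x k)\<^sup>2) / n"
    by (simp add: W_def G_def diff_divide_distrib[symmetric] power_divide sum_divide_distrib)
  also have "g\<^sup>2 = (\<Sum>k<n. (x k)\<^sup>2) / n"
    by (simp add: g2 G_def power_divide sum_divide_distrib)
  finally show ?thesis by (simp add: G_def)
qed

section \<open>Error of the rounded unit vectors, and the form on step functions\<close>

context coupled_gaussian_vectors
begin

text \<open>The rounding error has mean at most 6 (1 + 3) / m^2 by the fourth moment, and the
  deviation of the norm contributes 4 (2 / n).\<close>

lemma unit_vector_round_error:
  assumes m: "0 < m"
  shows "expectation (\<lambda>w. \<Sum>k<n. (unit_vector n (\<lambda>k. round_trunc m (X k w)) k - X k w / sqrt n)\<^sup>2)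
    \<le> 24 / (real m)\<^sup>2 + 8 / n"
proof -
  have "expectation (\<lambda>w. \<Sum>k<n. (unit_vector n (\<lambda>k. round_trunc m (X k w)) k - X k w / sqrt n)\<^sup>2)
    \<le> expectation (\<lambda>w. 6 * (\<Sum>k<n. (1 + (X k w) ^ 4) / (real m)\<^sup>2) / n + 4 * ((\<Sum>k<n. (X k w)\<^sup>2) / n - 1)\<^sup>2)"
  proof (rule integral_mono')
    show "integrable M (\<lambda>w. 6 * (\<Sum>k<n. (1 + (X k w) ^ 4) / (real m)\<^sup>2) / n + 4 * ((\<Sum>k<n. (X k w)\<^sup>2) / n - 1)\<^sup>2)"
      using X_moments sum_squares_concentration
      by (intro Bochner_Integration.integrable_add integrable_divide integrable_mult_right
          Bochner_Integration.integrable_sum) auto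
    fix w
    have "(\<Sum>k<n. (unit_vector n (\<lambda>k. round_trunc m (X k w)) k - X k w / sqrt n)\<^sup>2) \<le>
        6 * (\<Sum>k<n. (round_trunc m (X k w) - X k w)\<^sup>2) / n + 4 * ((\<Sum>k<n. (X k w)\<^sup>2) / n - 1)\<^sup>2"
      by (rule unit_vector_dist[OF n_pos])
    also have "\<dots> \<le> 6 * (\<Sum>k<n. (1 + (X k w) ^ 4) / (real m)\<^sup>2) / n + 4 * ((\<Sum>k<n. (X k w)\<^sup>2) / n - 1)\<^sup>2"
      using m by (intro add_right_mono divide_right_mono mult_left_mono sum_mono round_trunc_error) auto
    finally show "(\<Sum>k<n. (unit_vector n (\<lambda>k. round_trunc m (X k w)) k - X k w / sqrt n)\<^sup>2) \<le> \<dots>" .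
    show "0 \<le> 6 * (\<Sum>k<n. (1 + (X k w) ^ 4) / (real m)\<^sup>2) / n + 4 * ((\<Sum>k<n. (X k w)\<^sup>2) / n - 1)\<^sup>2"
      by (intro add_nonneg_nonneg divide_nonneg_nonneg mult_nonneg_nonneg sum_nonneg) auto
  qed
  also have "\<dots> = 6 * (\<Sum>k<n. 4 / (real m)\<^sup>2) / n + 4 * (2 / n)"
  proof -
    have 1: "integrable M (\<lambda>w. (1 + (X k w) ^ 4) / (real m)\<^sup>2)"
      "expectation (\<lambda>w. (1 + (X k w) ^ 4) / (real m)\<^sup>2) = 4 / (real m)\<^sup>2" if "k < n" for k
      using X_moments[OF that] by (auto simp: prob_space)
    then have "expectation (\<lambda>w. \<Sum>k<n. (1 + (X k w) ^ 4) / (real m)\<^sup>2) =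
        (\<Sum>k<n. expectation (\<lambda>w. (1 + (X k w) ^ 4) / (real m)\<^sup>2))"
      by (intro Bochner_Integration.integral_sum) auto
    also have "\<dots> = (\<Sum>k<n. 4 / (real m)\<^sup>2)"
      using 1 by (intro sum.cong refl) (simp only: lessThan_iff)
    finally have "expectation (\<lambda>w. \<Sum>k<n. (1 + (X k w) ^ 4) / (real m)\<^sup>2) = (\<Sum>k<n. 4 / (real m)\<^sup>2)" .
    moreover have "integrable M (\<lambda>w. \<Sum>k<n. (1 + (X k w) ^ 4) / (real m)\<^sup>2)"
      using 1 by (intro Bochner_Integration.integrable_sum) auto
    ultimately show ?thesis using sum_squares_concentration by simp
  qed
  also have "\<dots> = 24 / (real m)\<^sup>2 + 8 / n" using n_pos by simp
  finally show ?thesis .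
qed

text \<open>By bilinearity, the form on functions of the cell index is given by the matrix of its
  values on the indicators of the cells. This matrix is the one used for the Grothendieck
  constant.\<close>

lemma dr_form_step_functions:
  fixes \<iota> :: "(nat \<Rightarrow> real) \<Rightarrow> nat" and p q :: "nat \<Rightarrow> real"
  assumes [measurable]: "\<iota> \<in> measurable P (count_space UNIV)" and iota: "\<And>z. \<iota> z < N"
  shows "(\<Sum>i<N. \<Sum>j<N. dr_form (\<lambda>z. of_bool (\<iota> z = i)) (\<lambda>z. of_bool (\<iota> z = j)) * (p i * q j)) =
    dr_form (\<lambda>z. p (\<iota> z)) (\<lambda>z. q (\<iota> z))"
proof -
  let ?I = "\<lambda>i z. of_bool (\<iota> z = i) :: real"
  have split: "r (\<iota> z) = (\<Sum>i<N. r i * ?I i z)" for r :: "nat \<Rightarrow> real" and z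
    using iota[of z] by (simp add: of_bool_def if_distrib[of "\<lambda>x. _ * x"] cong: if_cong)
  have L: "expectation (\<lambda>w. r (\<iota> (\<xi> w)) * X l w) = (\<Sum>i<N. r i * expectation (\<lambda>w. ?I i (\<xi> w) * X l w))"
    if "l < n" for l and r :: "nat \<Rightarrow> real"
  proof -
    have int: "integrable M (\<lambda>w. ?I i (\<xi> w) * X l w)" for i
      by (rule integrable_mult_X[where B=1]) (use that in auto)
    have "expectation (\<lambda>w. r (\<iota> (\<xi> w)) * X l w) = expectation (\<lambda>w. \<Sum>i<N. r i * (?I i (\<xi> w) * X l w))"
      unfolding split[of r] by (simp only: sum_distrib_right mult.assoc)
    then show ?thesis using int by (simp add: Bochner_Integration.integral_sum)
  qed
  have B: "expectation (\<lambda>w. r (\<iota> (a w)) * s (\<iota> (b w))) =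
      (\<Sum>i<N. \<Sum>j<N. (r i * s j) * expectation (\<lambda>w. ?I i (a w) * ?I j (b w)))"
    if [measurable]: "a \<in> measurable M P" "b \<in> measurable M P" for a b and r s :: "nat \<Rightarrow> real"
  proof -
    have int: "integrable M (\<lambda>w. ?I i (a w) * ?I j (b w))" for i j
      by (rule integrable_bounded[where B=1]) auto
    have "expectation (\<lambda>w. r (\<iota> (a w)) * s (\<iota> (b w))) =
        expectation (\<lambda>w. \<Sum>i<N. \<Sum>j<N. (r i * s j) * (?I i (a w) * ?I j (b w)))"
      unfolding split[of r] split[of s] by (simp only: sum_product mult_ac)
    also have "\<dots> = (\<Sum>i<N. expectation (\<lambda>w. \<Sum>j<N. (r i * s j) * (?I i (a w) * ?I j (b w))))"
      using int by (intro Bochner_Integration.integral_sum Bochner_Integration.integrable_sum integrable_mult_right) auto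
    also have "\<dots> = (\<Sum>i<N. \<Sum>j<N. (r i * s j) * expectation (\<lambda>w. ?I i (a w) * ?I j (b w)))"
      using int by (intro sum.cong refl) (simp add: Bochner_Integration.integral_sum)
    finally show ?thesis .
  qed
  have form: "dr_form f g = (\<Sum>l<n. expectation (\<lambda>w. f (\<xi> w) * X l w) * expectation (\<lambda>w. g (\<xi> w) * X l w))
      - (lambda_star - 1 / 50) * expectation (\<lambda>w. f (\<xi> w) * g (\<xi> w))
      - 1 / 100 * (expectation (\<lambda>w. f (\<xi> w) * g (\<eta> w)) + expectation (\<lambda>w. f (\<eta> w) * g (\<xi> w)))"
    if [measurable]: "f \<in> borel_measurable P" "g \<in> borel_measurable P"
      and b: "\<And>z. \<bar>f z\<bar> \<le> K" "\<And>z. \<bar>g z\<bar> \<le> K" for f g K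
  proof -
    have "\<bar>f y * g z\<bar> \<le> K * K" for y z
      unfolding abs_mult using b order_trans[OF abs_ge_zero b(1)] by (intro mult_mono) auto
    then have "integrable M (\<lambda>w. f (\<xi> w) * g (\<eta> w))" "integrable M (\<lambda>w. f (\<eta> w) * g (\<xi> w))"
      by (auto intro!: integrable_bounded[where B="K * K"])
    then show ?thesis unfolding dr_form_def by simp
  qed
  \<comment> \<open>A step function takes at most \<open>N\<close> values, so it is bounded, as
    \<open>form\<close> requires for integrability.\<close>
  define K where "K = (\<Sum>i<N. \<bar>p i\<bar>) + (\<Sum>i<N. \<bar>q i\<bar>)"
  have K: "\<bar>p (\<iota> z)\<bar> \<le> K" "\<bar>q (\<iota> z)\<bar> \<le> K" for z
    using member_le_sum[of "\<iota> z" "{..<N}" "\<lambda>i. \<bar>p i\<bar>"] member_le_sum[of "\<iota> z" "{..<N}" "\<lambda>i. \<bar>q i\<bar>"] iota[of z]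
      sum_nonneg[of "{..<N}" "\<lambda>i. \<bar>p i\<bar>"] sum_nonneg[of "{..<N}" "\<lambda>i. \<bar>q i\<bar>"]
    by (auto simp: K_def)
  have f1: "dr_form (?I i) (?I j) = (\<Sum>l<n. expectation (\<lambda>w. ?I i (\<xi> w) * X l w) * expectation (\<lambda>w. ?I j (\<xi> w) * X l w))
      - (lambda_star - 1 / 50) * expectation (\<lambda>w. ?I i (\<xi> w) * ?I j (\<xi> w))
      - 1 / 100 * (expectation (\<lambda>w. ?I i (\<xi> w) * ?I j (\<eta> w)) + expectation (\<lambda>w. ?I i (\<eta> w) * ?I j (\<xi> w)))" for i j
    by (rule form[of _ _ 1]) auto
  have f2: "dr_form (\<lambda>z. p (\<iota> z)) (\<lambda>z. q (\<iota> z)) =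
      (\<Sum>l<n. expectation (\<lambda>w. p (\<iota> (\<xi> w)) * X l w) * expectation (\<lambda>w. q (\<iota> (\<xi> w)) * X l w))
      - (lambda_star - 1 / 50) * expectation (\<lambda>w. p (\<iota> (\<xi> w)) * q (\<iota> (\<xi> w)))
      - 1 / 100 * (expectation (\<lambda>w. p (\<iota> (\<xi> w)) * q (\<iota> (\<eta> w))) + expectation (\<lambda>w. p (\<iota> (\<eta> w)) * q (\<iota> (\<xi> w))))"
    by (rule form[OF _ _ K]) measurable
  have LL: "(\<Sum>l<n. expectation (\<lambda>w. p (\<iota> (\<xi> w)) * X l w) * expectation (\<lambda>w. q (\<iota> (\<xi> w)) * X l w)) =
      (\<Sum>i<N. \<Sum>j<N. (p i * q j) * (\<Sum>l<n. expectation (\<lambda>w. ?I i (\<xi> w) * X l w) * expectation (\<lambda>w. ?I j (\<xi> w) * X l w)))"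
  proof -
    have "(\<Sum>l<n. expectation (\<lambda>w. p (\<iota> (\<xi> w)) * X l w) * expectation (\<lambda>w. q (\<iota> (\<xi> w)) * X l w)) =
      (\<Sum>l<n. \<Sum>i<N. \<Sum>j<N. (p i * q j) * (expectation (\<lambda>w. ?I i (\<xi> w) * X l w) * expectation (\<lambda>w. ?I j (\<xi> w) * X l w)))"
      using L by (intro sum.cong refl) (simp add: sum_product mult_ac)
    also have "\<dots> = (\<Sum>i<N. \<Sum>l<n. \<Sum>j<N. (p i * q j) * (expectation (\<lambda>w. ?I i (\<xi> w) * X l w) * expectation (\<lambda>w. ?I j (\<xi> w) * X l w)))"
      by (rule sum.swap)
    also have "\<dots> = (\<Sum>i<N. \<Sum>j<N. \<Sum>l<n. (p i * q j) * (expectation (\<lambda>w. ?I i (\<xi> w) * X l w) * expectation (\<lambda>w. ?I j (\<xi> w) * X l w)))"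
      by (intro sum.cong refl sum.swap)
    finally show ?thesis by (simp add: sum_distrib_left)
  qed
  show ?thesis
    unfolding f1 f2 LL B[OF xi_measurable xi_measurable] B[OF xi_measurable eta_measurable] B[OF eta_measurable xi_measurable]
    unfolding sum_distrib_left sum.distrib[symmetric] sum_subtractf[symmetric]
    by (intro sum.cong refl) (simp only: left_diff_distrib right_diff_distrib distrib_left distrib_right sum_distrib_right sum_distrib_left mult_ac)
qed

end

section \<open>From step functions to matrices\<close>

lemma abs_euclidean_inner_le_1:
  assumes "L2_set u {..<d} = 1" "L2_set v {..<d} = 1"
  shows "\<bar>euclidean_inner d u v\<bar> \<le> 1"
proof -
  have "\<bar>euclidean_inner d u v\<bar> \<le> (\<Sum>k<d. \<bar>u k * v k\<bar>)"
    unfolding euclidean_inner_def by (rule sum_abs)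
  also have "\<dots> \<le> 1" using L2_set_mult_ineq[of u v "{..<d}"] assms by (simp add: abs_mult)
  finally show ?thesis .
qed

text \<open>A real \<open>Sup\<close> needs an upper bound; by the Cauchy--Schwarz inequality the
  sum of the |A i j| serves.\<close>

lemma vector_max_ge:
  assumes "\<And>i. i < N \<Longrightarrow> L2_set (x i) {..<d} = 1" "\<And>j. j < N \<Longrightarrow> L2_set (y j) {..<d} = 1"
  shows "(\<Sum>i<N. \<Sum>j<N. A i j * euclidean_inner d (x i) (y j)) \<le> vector_max N A"
  unfolding vector_max_def
proof (rule cSup_upper)
  show "bdd_above {(\<Sum>i<N. \<Sum>j<N. A i j * euclidean_inner d (x i) (y j)) | d x y.
            (\<forall>i<N. L2_set (x i) {..<d} = 1) \<and> (\<forall>j<N. L2_set (y j) {..<d} = 1)}"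
  proof (rule bdd_aboveI, clarify)
    fix d and x y :: "nat \<Rightarrow> nat \<Rightarrow> real"
    assume u: "\<forall>i<N. L2_set (x i) {..<d} = 1" "\<forall>j<N. L2_set (y j) {..<d} = 1"
    have "A i j * euclidean_inner d (x i) (y j) \<le> \<bar>A i j\<bar>" if "i < N" "j < N" for i j
    proof -
      have "\<bar>A i j * euclidean_inner d (x i) (y j)\<bar> \<le> \<bar>A i j\<bar> * 1"
        unfolding abs_mult using u that by (intro mult_left_mono abs_euclidean_inner_le_1) auto
      then show ?thesis by simp
    qed
    then show "(\<Sum>i<N. \<Sum>j<N. A i j * euclidean_inner d (x i) (y j)) \<le> (\<Sum>i<N. \<Sum>j<N. \<bar>A i j\<bar>)"
      by (intro sum_mono) auto
  qed
qed (use assms in blast)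

lemma finite_sign_values:
  fixes N :: nat
  shows "finite {(\<Sum>i<N. \<Sum>j<N. A i j * x i * y j) | x y.
     x \<in> {..<N} \<rightarrow>\<^sub>E {-1, 1} \<and> y \<in> {..<N} \<rightarrow>\<^sub>E {-1, 1 :: real}}"
proof (rule finite_subset)
  show "{(\<Sum>i<N. \<Sum>j<N. A i j * x i * y j) | x y.
     x \<in> {..<N} \<rightarrow>\<^sub>E {-1, 1} \<and> y \<in> {..<N} \<rightarrow>\<^sub>E {-1, 1 :: real}} \<subseteq>
    (\<lambda>(x, y). \<Sum>i<N. \<Sum>j<N. A i j * x i * y j) ` (({..<N} \<rightarrow>\<^sub>E {-1, 1}) \<times> ({..<N} \<rightarrow>\<^sub>E {-1, 1}))"
    by auto
qed (intro finite_imageI finite_cartesian_product finite_PiE, auto)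

lemma sign_max_ge:
  assumes "x \<in> {..<N} \<rightarrow>\<^sub>E {-1, 1}" "y \<in> {..<N} \<rightarrow>\<^sub>E {-1, 1}"
  shows "(\<Sum>i<N. \<Sum>j<N. A i j * x i * y j) \<le> sign_max N A"
  unfolding sign_max_def using assms by (intro Max_ge finite_sign_values) blast

lemma sign_max_le:
  assumes "\<And>x y. x \<in> {..<N} \<rightarrow>\<^sub>E {-1, 1} \<Longrightarrow> y \<in> {..<N} \<rightarrow>\<^sub>E {-1, 1} \<Longrightarrow>
    (\<Sum>i<N. \<Sum>j<N. A i j * x i * y j) \<le> B"
  shows "sign_max N A \<le> B"
  unfolding sign_max_def
proof (rule Max.boundedI[OF finite_sign_values])
  have "(\<lambda>i\<in>{..<N}. 1) \<in> {..<N} \<rightarrow>\<^sub>E {-1, 1 :: real}" by (simp add: restrict_PiE_iff)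
  then show "{(\<Sum>i<N. \<Sum>j<N. A i j * x i * y j) | x y.
     x \<in> {..<N} \<rightarrow>\<^sub>E {-1, 1} \<and> y \<in> {..<N} \<rightarrow>\<^sub>E {-1, 1 :: real}} \<noteq> {}" by blast
qed (use assms in blast)

lemma grothendieck_constant_ge:
  assumes "i < N" "j < N" "A i j \<noteq> 0"
  shows "ereal (vector_max N A / sign_max N A) \<le> grothendieck_constant"
  unfolding grothendieck_constant_def
proof (rule SUP_upper2[of N])
  show "ereal (vector_max N A / sign_max N A) \<le>
      (SUP A \<in> {A. \<exists>i<N. \<exists>j<N. A i j \<noteq> 0}. ereal (vector_max N A / sign_max N A))"
    using assms by (intro SUP_upper) blast
qed simp

section \<open>The matrix of the form and its quotient\<close>

context coupled_gaussian_vectors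
begin

text \<open>The space is cut into finitely many cells on which the rounded point is constant. Sign
  vectors on the cells are sign functions, bounded by \<open>dr_form_sign_le\<close>; normalised
  rounded points are unit vectors, to which \<open>dr_form_unit_vectors_ge\<close> applies.\<close>

lemma grothendieck_constant_ge_ratio:
  assumes m: "0 < m"
    and nonneg: "0 \<le> 1 - lambda_star + \<kappa> / 100 - 2 * (24 / (real m)\<^sup>2 + 8 / n)"
  shows "ereal ((1 - lambda_star + \<kappa> / 100 - 2 * (24 / (real m)\<^sup>2 + 8 / n)) /
      ((1 - lambda_star) * (4 * (std_normal_density C_star)\<^sup>2) + 300 * \<kappa>\<^sup>2)) \<le> grothendieck_constant"
proof -
  define cell where "cell z = (\<lambda>k\<in>{..<n}. round_trunc m (z k))" for z :: "nat \<Rightarrow> real"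
  define Q where "Q = {..<n} \<rightarrow>\<^sub>E range (round_trunc m)"
  have finQ: "finite Q" unfolding Q_def by (intro finite_PiE finite_range_round_trunc) auto
  have cellQ: "cell z \<in> Q" for z by (auto simp: cell_def Q_def)
  have cell_meas [measurable]: "cell \<in> measurable P (count_space Q)"
    unfolding measurable_count_space_eq2[OF finQ]
  proof (intro conjI ballI)
    fix q assume q: "q \<in> Q"
    have "cell -` {q} \<inter> space P = {z \<in> space P. \<forall>k\<in>{..<n}. round_trunc m (z k) = q k}"
      using q by (fastforce simp: cell_def Q_def PiE_def extensional_def fun_eq_iff)
    also have "\<dots> \<in> sets P" by measurable
    finally show "cell -` {q} \<inter> space P \<in> sets P" .
  qed (use cellQ in auto)
  define N where "N = card Q"
  obtain h where h: "bij_betw h {..<N} Q"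
    using ex_bij_betw_nat_finite[OF finQ] by (auto simp: N_def atLeast0LessThan)
  define \<iota> where "\<iota> z = inv_into {..<N} h (cell z)" for z
  have h_iota: "h (\<iota> z) = cell z" for z
    unfolding \<iota>_def using h cellQ[of z] by (metis bij_betw_imp_surj_on f_inv_into_f)
  have iotaN: "\<iota> z < N" for z
    unfolding \<iota>_def using h cellQ[of z] by (metis bij_betw_imp_surj_on inv_into_into lessThan_iff)
  have iota_meas [measurable]: "\<iota> \<in> measurable P (count_space UNIV)"
    unfolding \<iota>_def by (rule measurable_compose[OF cell_meas]) simp
  define A where "A i j = dr_form (\<lambda>z. of_bool (\<iota> z = i)) (\<lambda>z. of_bool (\<iota> z = j))" for i j
  have A: "(\<Sum>i<N. \<Sum>j<N. A i j * p i * q j) = dr_form (\<lambda>z. p (\<iota> z)) (\<lambda>z. q (\<iota> z))" for p q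
    using dr_form_step_functions[OF iota_meas iotaN, of p q] by (simp add: A_def mult.assoc)
  let ?D = "(1 - lambda_star) * (4 * (std_normal_density C_star)\<^sup>2) + 300 * \<kappa>\<^sup>2"
  let ?V = "1 - lambda_star + \<kappa> / 100 - 2 * (24 / (real m)\<^sup>2 + 8 / n)"
  have up: "sign_max N A \<le> ?D"
  proof (rule sign_max_le)
    fix x y assume "x \<in> {..<N} \<rightarrow>\<^sub>E {-1, 1 :: real}" "y \<in> {..<N} \<rightarrow>\<^sub>E {-1, 1 :: real}"
    then have "x i = 1 \<or> x i = -1" "y i = 1 \<or> y i = -1" if "i < N" for i using that by (auto simp: PiE_iff)
    then show "(\<Sum>i<N. \<Sum>j<N. A i j * x i * y j) \<le> ?D"
      unfolding A using iotaN by (intro dr_form_sign_le) auto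
  qed
  \<comment> \<open>The constant functions 1 and -1 have no linear part, and their form is
    \<open>lambda_star\<close> > 0. This shows both that \<open>A\<close> is nonzero and that the
    denominator is positive.\<close>
  have val: "(\<Sum>i<N. \<Sum>j<N. A i j * (\<lambda>i\<in>{..<N}. 1) i * (\<lambda>j\<in>{..<N}. - 1) j) = lambda_star"
    unfolding A using iotaN X_moments(1) by (simp add: dr_form_def prob_space)
  have "lambda_star \<le> sign_max N A"
    unfolding val[symmetric]
    by (rule sign_max_ge[of "\<lambda>i\<in>{..<N}. 1" N "\<lambda>j\<in>{..<N}. - 1" A]; simp only: restrict_PiE_iff) simp_all
  then have pos: "0 < sign_max N A" using lambda_star_bounds by linarith
  have "\<exists>i<N. \<exists>j<N. A i j \<noteq> 0"
  proof (rule ccontr)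
    assume "\<not> ?thesis"
    then have "lambda_star = 0" unfolding val[symmetric] by (intro sum.neutral ballI) auto
    then show False using lambda_star_bounds by simp
  qed
  then obtain i j where ij: "i < N" "j < N" "A i j \<noteq> 0" by blast
  have "?V \<le> vector_max N A"
  proof -
    \<comment> \<open>Cell \<open>i\<close> carries the normalised rounded point
      \<open>unit_vector n (h i)\<close>, used for row and column alike. Its \<open>k\<close>-th
      coordinate is the step function \<open>F k\<close>, so summing over \<open>k\<close> yields
      inner products.\<close>
    define F where "F k z = unit_vector n (h (\<iota> z)) k" for k z
    have F_eq: "F k z = unit_vector n (\<lambda>k. round_trunc m (z k)) k" if "k < n" for k z
      using that unfolding F_def h_iota by (intro unit_vector_cong) (auto simp: cell_def)
    have "?V \<le> (\<Sum>k<n. dr_form (F k) (F k))"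
    proof (rule dr_form_unit_vectors_ge)
      show "F k \<in> borel_measurable P" for k unfolding F_def by measurable
      show "(\<Sum>k<n. (F k z)\<^sup>2) = 1" for z unfolding F_def by (rule unit_vector_norm[OF n_pos])
      have "expectation (\<lambda>w. \<Sum>k<n. (F k (\<xi> w) - X k w / sqrt n)\<^sup>2) =
        expectation (\<lambda>w. \<Sum>k<n. (unit_vector n (\<lambda>k. round_trunc m (X k w)) k - X k w / sqrt n)\<^sup>2)"
      proof (intro Bochner_Integration.integral_cong sum.cong refl)
        fix w k assume "k \<in> {..<n}"
        then have "F k (\<xi> w) = unit_vector n (\<lambda>k. round_trunc m (X k w)) k"
          unfolding F_eq[OF \<open>k \<in> {..<n}\<close>[unfolded lessThan_iff]] by (intro unit_vector_cong) auto
        then show "(F k (\<xi> w) - X k w / sqrt n)\<^sup>2 =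
            (unit_vector n (\<lambda>k. round_trunc m (X k w)) k - X k w / sqrt n)\<^sup>2" by simp
      qed
      then show "expectation (\<lambda>w. \<Sum>k<n. (F k (\<xi> w) - X k w / sqrt n)\<^sup>2) \<le> 24 / (real m)\<^sup>2 + 8 / n"
        using unit_vector_round_error[OF m] by simp
    qed
    also have "\<dots> = (\<Sum>k<n. \<Sum>i<N. \<Sum>j<N. A i j * unit_vector n (h i) k * unit_vector n (h j) k)"
      unfolding F_def A ..
    also have "\<dots> = (\<Sum>i<N. \<Sum>k<n. \<Sum>j<N. A i j * unit_vector n (h i) k * unit_vector n (h j) k)"
      by (rule sum.swap)
    also have "\<dots> = (\<Sum>i<N. \<Sum>j<N. \<Sum>k<n. A i j * unit_vector n (h i) k * unit_vector n (h j) k)"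
      by (intro sum.cong refl sum.swap)
    also have "\<dots> = (\<Sum>i<N. \<Sum>j<N. A i j * euclidean_inner n (unit_vector n (h i)) (unit_vector n (h j)))"
      by (simp add: euclidean_inner_def sum_distrib_left mult.assoc)
    also have "\<dots> \<le> vector_max N A"
      by (rule vector_max_ge) (simp_all add: L2_set_def unit_vector_norm n_pos)
    finally show ?thesis .
  qed
  then have "?V / ?D \<le> vector_max N A / sign_max N A"
    using nonneg up pos by (intro frac_le) auto
  then show ?thesis
    using grothendieck_constant_ge[of i N j A, OF ij] by (meson ereal_less_eq(3) order_trans)
qed

text \<open>The gain \<kappa>/100 is 10^-7 and the loss 300 \<kappa>^2 is 3 * 10^-8, at most 5.3 *
  10^-8 after division by p \<ge> 57/100. With mesh 10^-6 and this dimension the discretisation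
  error is below 10^-8, which leaves a gain of at least 9 * 10^-8 in the numerator.\<close>

lemma grothendieck_constant_ge_davie_reeds:
  assumes kappa: "\<kappa> = 1 / 10 ^ 5" and n: "10 ^ 11 \<le> n"
  shows "ereal (davie_reeds_bound + 1 / 10 ^ 12) \<le> grothendieck_constant"
proof -
  define p where "p = 4 * (std_normal_density C_star)\<^sup>2"
  define V where "V = 1 - lambda_star + \<kappa> / 100 - 2 * (24 / (real (10 ^ 6))\<^sup>2 + 8 / n)"
  define D where "D = (1 - lambda_star) * p + 300 * \<kappa>\<^sup>2"
  have p: "57 / 100 \<le> p" "p \<le> 64 / 100" unfolding p_def by (rule davie_reeds_value_bounds)+
  have l: "15 / 100 \<le> lambda_star" "lambda_star \<le> 24 / 100" by (rule lambda_star_bounds)+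
  have "real (10 ^ 11) \<le> real n" using n by (rule of_nat_mono)
  then have "8 / real n \<le> 8 / 10 ^ 11" by (intro frac_le) auto
  then have V: "1 - lambda_star + 9 / 10 ^ 8 \<le> V"
    unfolding kappa V_def by (simp add: power_divide)
  have D_eq: "D = (1 - lambda_star) * p + 3 / 10 ^ 8" by (simp add: D_def kappa power_divide)
  have "(1 - lambda_star) * p \<le> 1 * 1" using p l by (intro mult_mono) auto
  then have D: "D \<le> 2" using D_eq by simp
  have "0 \<le> (1 - lambda_star) * p" using p l by (intro mult_nonneg_nonneg) auto
  then have D0: "0 < D" by (simp add: D_eq)
  have "(1 / p + 1 / 10 ^ 12) * D = D / p + D / 10 ^ 12" by (simp add: distrib_right)
  also have "D / p = (1 - lambda_star) + 3 / 10 ^ 8 / p"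
    using p by (simp add: D_eq add_divide_distrib)
  also have "3 / 10 ^ 8 / p \<le> 3 / 10 ^ 8 / (57 / 100)" using p by (intro divide_left_mono) auto
  also have "(1 - lambda_star) + 3 / 10 ^ 8 / (57 / 100) + D / 10 ^ 12 \<le> V"
    using V D by simp
  finally have "1 / p + 1 / 10 ^ 12 \<le> V / D" using D0 by (simp add: pos_le_divide_eq)
  moreover have "0 \<le> V" using V l by simp
  then have "ereal (V / D) \<le> grothendieck_constant"
    using grothendieck_constant_ge_ratio[of "10 ^ 6"] unfolding V_def D_def p_def by simp
  ultimately show ?thesis
    unfolding davie_reeds_bound_eq p_def[symmetric] by (meson ereal_less_eq(3) order_trans)
qed

end

section \<open>Coupled Gaussian vectors\<close>

text \<open>Independence means that the joint law is the product of the marginals, and the joint law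
  of the coordinates is the product measure itself.\<close>

lemma gaussian_product_independent:
  assumes "finite I" "I \<noteq> {}"
  defines "M \<equiv> Pi\<^sub>M I (\<lambda>_. density lborel std_normal_density)"
  shows "prob_space.indep_vars M (\<lambda>_. borel) (\<lambda>i w. w i) I"
proof -
  interpret N: prob_space "density lborel std_normal_density"
    by (rule prob_space_normal_density) simp
  interpret prob_space M
    unfolding M_def by (intro prob_space_PiM N.prob_space_axioms)
  have meas: "(\<lambda>w. w i) \<in> borel_measurable M" if "i \<in> I" for i
    using measurable_component_singleton[OF that, of "\<lambda>_. density lborel std_normal_density"] by (simp add: M_def)
  have sets: "sets (Pi\<^sub>M I (\<lambda>_. borel)) = sets M"
    unfolding M_def by (intro sets_PiM_cong) auto
  have "distr M (Pi\<^sub>M I (\<lambda>_. borel)) (\<lambda>x. \<lambda>i\<in>I. x i) = distr M M (\<lambda>x. x)"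
    by (intro distr_cong sets) (auto simp: M_def space_PiM PiE_def extensional_restrict)
  also have "\<dots> = M" by simp
  also have "\<dots> = (\<Pi>\<^sub>M i\<in>I. distr M borel (\<lambda>w. w i))"
    unfolding M_def
  proof (intro PiM_cong refl)
    fix i assume i: "i \<in> I"
    have "distr (Pi\<^sub>M I (\<lambda>_. density lborel std_normal_density)) borel (\<lambda>w. w i) =
      distr (Pi\<^sub>M I (\<lambda>_. density lborel std_normal_density)) (density lborel std_normal_density) (\<lambda>w. w i)"
      by (intro distr_cong) auto
    also have "\<dots> = density lborel std_normal_density"
      using i by (intro distr_PiM_component N.prob_space_axioms)
    finally show "density lborel std_normal_density =
        distr (Pi\<^sub>M I (\<lambda>_. density lborel std_normal_density)) borel (\<lambda>w. w i)" ..
  qed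
  finally show ?thesis
    using assms meas by (subst indep_vars_iff_distr_eq_PiM') auto
qed

lemma gaussian_product_linear:
  assumes I: "finite I" and c: "(\<Sum>i\<in>I. (c i)\<^sup>2) = s\<^sup>2" and s: "0 < s"
  defines "M \<equiv> Pi\<^sub>M I (\<lambda>_. density lborel std_normal_density)"
  shows "distributed M lborel (\<lambda>w. \<Sum>i\<in>I. c i * w i) (normal_density 0 s)"
proof -
  have "I \<noteq> {}" using c s by auto
  interpret N: prob_space "density lborel std_normal_density"
    by (rule prob_space_normal_density) simp
  interpret prob_space M
    unfolding M_def by (intro prob_space_PiM N.prob_space_axioms)
  have ind: "indep_vars (\<lambda>_. borel) (\<lambda>i w. w i) I"
    using gaussian_product_independent[OF I \<open>I \<noteq> {}\<close>] by (simp add: M_def)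
  have std: "distributed M lborel (\<lambda>w. w i) std_normal_density" if i: "i \<in> I" for i
  proof -
    have "distr M lborel (\<lambda>w. w i) = distr M (density lborel std_normal_density) (\<lambda>w. w i)"
      by (intro distr_cong) auto
    also have "\<dots> = density lborel std_normal_density"
      unfolding M_def using i by (intro distr_PiM_component N.prob_space_axioms)
    finally show ?thesis
      using measurable_component_singleton[OF i, of "\<lambda>_. density lborel std_normal_density"]
      by (simp add: distributed_def M_def)
  qed
  \<comment> \<open>Zero coefficients are dropped because \<open>sum_indep_normal\<close> requires
    positive standard deviations.\<close>
  define J where "J = {i \<in> I. c i \<noteq> 0}"
  have J: "finite J" "J \<subseteq> I" using I by (auto simp: J_def)
  have sumJ: "(\<Sum>i\<in>I. f i) = (\<Sum>i\<in>J. f i)" if "\<And>i. c i = 0 \<Longrightarrow> f i = 0" for f :: "_ \<Rightarrow> real"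
    using I that by (intro sum.mono_neutral_right) (auto simp: J_def)
  have cJ: "(\<Sum>i\<in>J. (c i)\<^sup>2) = s\<^sup>2" using c by (subst (asm) sumJ) auto
  have "J \<noteq> {}" using cJ s by auto
  have "distributed M lborel (\<lambda>w. \<Sum>i\<in>J. c i * w i)
      (normal_density (\<Sum>i\<in>J. 0) (sqrt (\<Sum>i\<in>J. \<bar>c i\<bar>\<^sup>2)))"
  proof (rule sum_indep_normal[OF J(1) \<open>J \<noteq> {}\<close>])
    show "indep_vars (\<lambda>_. borel) (\<lambda>i w. c i * w i) J"
      using indep_vars_compose2[OF indep_vars_subset[OF ind J(2)], of "\<lambda>i x. c i * x" "\<lambda>_. borel"] by simp
    fix i assume i: "i \<in> J"
    then show "0 < \<bar>c i\<bar>" by (simp add: J_def)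
    show "distributed M lborel (\<lambda>w. c i * w i) (normal_density 0 \<bar>c i\<bar>)"
      using normal_density_affine[OF std zero_less_one, of i "c i" 0] i by (simp add: J_def)
  qed
  then show ?thesis using s by (subst sumJ) (simp_all add: cJ)
qed

text \<open>From independent standard Gaussian vectors g and g', take X = g and Y = (1 - \<kappa>) g
  + \<sigma> g' with \<sigma>^2 = 1 - (1 - \<kappa>)^2. Then X - Y has coordinate variance
  \<kappa>^2 + \<sigma>^2 = 2 \<kappa>.\<close>

lemma coupled_gaussian_vectors_exists:
  fixes n :: nat and \<kappa> :: real
  assumes n: "0 < n" and kappa: "0 < \<kappa>" "\<kappa> \<le> 1"
  shows "\<exists>(M :: (nat \<times> bool \<Rightarrow> real) measure) X Y. coupled_gaussian_vectors M n X Y \<kappa>"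
proof -
  define I where "I = {..<n} \<times> (UNIV :: bool set)"
  define M where "M = Pi\<^sub>M I (\<lambda>_. density lborel std_normal_density)"
  define \<sigma> where "\<sigma> = sqrt (2 * \<kappa> - \<kappa>\<^sup>2)"
  define Z where "Z a b k w = a * w (k, False) + b * w (k, True)" for a b k and w :: "nat \<times> bool \<Rightarrow> real"
  have I: "finite I" "I \<noteq> {}" using n by (auto simp: I_def)
  have "\<kappa>\<^sup>2 \<le> \<kappa>" using kappa by (simp add: power2_eq_square mult_left_le)
  then have sig: "\<sigma>\<^sup>2 = 2 * \<kappa> - \<kappa>\<^sup>2" using kappa by (simp add: \<sigma>_def)
  interpret N: prob_space "density lborel std_normal_density"
    by (rule prob_space_normal_density) simp
  interpret prob_space M
    unfolding M_def by (intro prob_space_PiM N.prob_space_axioms)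
  have ind: "indep_vars (\<lambda>_. borel) (\<lambda>i w. w i) I"
    using gaussian_product_independent[OF I] by (simp add: M_def)
  \<comment> \<open>One computation covers X, Y and X - Y, with (a, b) equal to (1, 0), (1 -
    \<kappa>, \<sigma>) and (\<kappa>, -\<sigma>).\<close>
  have lin: "distributed M lborel (\<lambda>w. \<Sum>k<n. e k * Z a b k w) (normal_density 0 s)"
    if "(a\<^sup>2 + b\<^sup>2) * (\<Sum>k<n. (e k)\<^sup>2) = s\<^sup>2" "0 < s" for a b e s
  proof -
    define c where "c i = e (fst i) * (if snd i then b else a)" for i
    have sum2: "(\<Sum>i\<in>I. f i) = (\<Sum>k<n. f (k, False) + f (k, True))" for f :: "_ \<Rightarrow> real"
      unfolding I_def by (simp add: sum.cartesian_product' UNIV_bool)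
    have "(\<Sum>i\<in>I. (c i)\<^sup>2) = s\<^sup>2"
      unfolding sum2 that(1)[symmetric] by (simp add: c_def power_mult_distrib sum_distrib_left sum.distrib algebra_simps)
    from gaussian_product_linear[OF I(1) this that(2)] show ?thesis
      unfolding sum2 by (simp add: M_def c_def Z_def algebra_simps)
  qed
  have coord: "distributed M lborel (Z a b k) std_normal_density" if k: "k < n" and ab: "a\<^sup>2 + b\<^sup>2 = 1" for a b k
  proof -
    have "(\<Sum>j<n. ((if j = k then 1 else 0) :: real)\<^sup>2) = 1"
      using k by (simp add: if_distrib[of "\<lambda>x. x\<^sup>2"] cong: if_cong)
    then show ?thesis
      using lin[of a b "\<lambda>j. if j = k then 1 else 0" 1] k ab
      by (simp add: if_distrib[of "\<lambda>x. x * _"] cong: if_cong)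
  qed
  have Zm: "Z a b k \<in> borel_measurable M" if "k < n" for a b k
  proof -
    have "(\<lambda>w. w (k, c)) \<in> borel_measurable M" for c
      using measurable_component_singleton[of "(k, c)" I "\<lambda>_. density lborel std_normal_density"] that
      by (simp add: M_def I_def)
    then show ?thesis unfolding Z_def by measurable
  qed
  have law: "distr M (Pi\<^sub>M {..<n} (\<lambda>_. borel)) (\<lambda>w. \<lambda>k\<in>{..<n}. Z a b k w) =
      Pi\<^sub>M {..<n} (\<lambda>_. density lborel std_normal_density)" if ab: "a\<^sup>2 + b\<^sup>2 = 1" for a b
  proof -
    \<comment> \<open>Coordinate \<open>k\<close> of \<open>Z a b\<close> depends only on the two
      variables with first index \<open>k\<close>, and disjoint blocks are independent. So the joint
      law is the same standard Gaussian whenever a^2 + b^2 = 1.\<close>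
    have "indep_vars (\<lambda>k. Pi\<^sub>M ({k} \<times> UNIV) (\<lambda>_. borel))
        (\<lambda>k w. restrict (\<lambda>i. w i) ({k} \<times> UNIV)) {..<n}"
      by (rule indep_vars_restrict[OF ind]) (auto simp: I_def disjoint_family_on_def)
    then have "indep_vars (\<lambda>_. borel) (\<lambda>k w. Z a b k (restrict (\<lambda>i. w i) ({k} \<times> UNIV))) {..<n}"
      by (rule indep_vars_compose2) (auto simp: Z_def)
    moreover have "Z a b k (restrict (\<lambda>i. w i) ({k} \<times> UNIV)) = Z a b k w" for k w
      by (simp add: Z_def)
    ultimately have "indep_vars (\<lambda>_. borel) (Z a b) {..<n}" by simp
    then have "distr M (Pi\<^sub>M {..<n} (\<lambda>_. borel)) (\<lambda>w. \<lambda>k\<in>{..<n}. Z a b k w) =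
        Pi\<^sub>M {..<n} (\<lambda>k. distr M borel (Z a b k))"
      using n Zm by (subst (asm) indep_vars_iff_distr_eq_PiM') auto
    also have "\<dots> = Pi\<^sub>M {..<n} (\<lambda>_. density lborel std_normal_density)"
    proof (intro PiM_cong refl)
      fix k assume "k \<in> {..<n}"
      then have "distr M lborel (Z a b k) = density lborel std_normal_density"
        using coord[OF _ ab] by (intro distributed_distr_eq_density) auto
      moreover have "distr M borel (Z a b k) = distr M lborel (Z a b k)"
        by (intro distr_cong) auto
      ultimately show "distr M borel (Z a b k) = density lborel std_normal_density" by simp
    qed
    finally show ?thesis .
  qed
  have ab: "(1 - \<kappa>)\<^sup>2 + \<sigma>\<^sup>2 = 1" unfolding sig by (simp add: power2_eq_square algebra_simps)
  have "coupled_gaussian_vectors M n (Z 1 0) (Z (1 - \<kappa>) \<sigma>) \<kappa>"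
  proof unfold_locales
    show "0 < n" "0 < \<kappa>" by fact+
    show "Z 1 0 k \<in> borel_measurable M" "Z (1 - \<kappa>) \<sigma> k \<in> borel_measurable M" if "k < n" for k
      using Zm[OF that] by auto
    show "distr M (Pi\<^sub>M {..<n} (\<lambda>_. borel)) (\<lambda>w. \<lambda>k\<in>{..<n}. Z 1 0 k w) =
      distr M (Pi\<^sub>M {..<n} (\<lambda>_. borel)) (\<lambda>w. \<lambda>k\<in>{..<n}. Z (1 - \<kappa>) \<sigma> k w)"
      using law[OF ab] law[of 1 0] by simp
    fix e :: "nat \<Rightarrow> real" assume e: "(\<Sum>k<n. (e k)\<^sup>2) = 1"
    show "distributed M lborel (\<lambda>w. \<Sum>k<n. e k * Z 1 0 k w) std_normal_density"
      by (rule lin) (simp_all add: e)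
    have "Z 1 0 k w - Z (1 - \<kappa>) \<sigma> k w = Z \<kappa> (- \<sigma>) k w" for k w
      by (simp add: Z_def algebra_simps)
    moreover have "distributed M lborel (\<lambda>w. \<Sum>k<n. e k * Z \<kappa> (- \<sigma>) k w) (normal_density 0 (sqrt (2 * \<kappa>)))"
      by (rule lin) (use kappa in \<open>simp_all add: e sig\<close>)
    ultimately show "distributed M lborel (\<lambda>w. \<Sum>k<n. e k * (Z 1 0 k w - Z (1 - \<kappa>) \<sigma> k w))
        (normal_density 0 (sqrt (2 * \<kappa>)))"
      by simp
  qed
  then show ?thesis by blast
qed

theorem theorem1p1:
  shows "grothendieck_constant \<ge> ereal (davie_reeds_bound + 1 / 10 ^ 12)"
proof -
  obtain M :: "(nat \<times> bool \<Rightarrow> real) measure" and X Y where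
    "coupled_gaussian_vectors M (10 ^ 11) X Y (1 / 10 ^ 5)"
    using coupled_gaussian_vectors_exists[of "10 ^ 11" "1 / 10 ^ 5"] by auto
  then show ?thesis
    by (intro coupled_gaussian_vectors.grothendieck_constant_ge_davie_reeds) auto
qed

end
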